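(* There exists a nonadaptive $O(\sqrt{d\log d})$-approximation algorithm for the distance to monotonicity that, given a parameter $\alpha\in(0,1)$ and oracle access to a function $f\colon\{0,1\}^d\to\mathbb{R}$ that is $\alpha$-far from monotone, makes $\mathrm{poly}(d,1/\alpha)$ queries.
   Context: The partial order on $\{0,1\}^d$ is $x\preceq y$ iff $x_i\le y_i$ for all $i$; $f$ is monotone if $f(x)\le f(y)$ whenever $x\preceq y$. The distance to monotonicity $\varepsilon(f)$ is the minimum of $\Pr_{\boldsymbol{x}}[f(\boldsymbol{x})\ne g(\boldsymbol{x})]$ over monotone $g$ ($\boldsymbol{x}$ uniform); $f$ is $\alpha$-far from monotone if $\varepsilon(f)\ge\alpha$. For $c>1$, a randomized $c$-approximation algorithm for the distance to monotonicity is given $\alpha\in(0,1)$ and oracle access to an $f$ that is $\alpha$-far from monotone, and outputs $\hat\varepsilon$ which with probability at least $2/3$ satisfies $\varepsilon(f)\le\hat\varepsilon\le c\cdot\varepsilon(f)$. It is nonadaptive if its queries do not depend on answers to previous queries. *)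

theory Defs
  imports "HOL-Probability.Probability" "HOL-Library.Landau_Symbols"
begin

text \<open>
  All points of \<^term>\<open>cube d\<close> agree outside \<open>{..<d}\<close>, so the pointwise order on
  \<^typ>\<open>nat \<Rightarrow> nat\<close>, restricted to \<^term>\<open>cube d\<close>, is the coordinatewise order on
  the first \<open>d\<close> coordinates. Functions on the cube are total functions of which only the values
  on \<^term>\<open>cube d\<close> matter; monotone means \<^term>\<open>mono_on (cube d) f\<close>.
\<close>

type_synonym point = "nat \<Rightarrow> nat"

definition cube :: "nat \<Rightarrow> point set" where
  "cube d = {..<d} \<rightarrow>\<^sub>E {0, 1}"

lemma finite_cube: "finite (cube d)"
  by (simp add: cube_def finite_PiE)

lemma cube_nonempty: "cube d \<noteq> {}"
  by (simp add: cube_def PiE_eq_empty_iff)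

lemma cube_le_iff:
  assumes "x \<in> cube d" "y \<in> cube d"
  shows "x \<le> y \<longleftrightarrow> (\<forall>i<d. x i \<le> y i)"
  using assms unfolding cube_def le_fun_def
  by (metis PiE_arb lessThan_iff order_refl)

definition disagreement :: "nat \<Rightarrow> (point \<Rightarrow> real) \<Rightarrow> (point \<Rightarrow> real) \<Rightarrow> real" where
  "disagreement d f g = measure_pmf.prob (pmf_of_set (cube d)) {x. f x \<noteq> g x}"

definition dist_mono :: "nat \<Rightarrow> (point \<Rightarrow> real) \<Rightarrow> real" where
  "dist_mono d f = Min {disagreement d f g | g. mono_on (cube d) g}"

text \<open>The minimum is taken over a finite nonempty set.\<close>

lemma finite_disagreements: "finite {disagreement d f g | g. mono_on (cube d) g}"
proof (rule finite_subset)
  show "{disagreement d f g | g. mono_on (cube d) g}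
    \<subseteq> measure_pmf.prob (pmf_of_set (cube d)) ` Pow (cube d)"
  proof
    fix r assume "r \<in> {disagreement d f g | g. mono_on (cube d) g}"
    then obtain g where "r = disagreement d f g" by blast
    moreover have "disagreement d f g
      = measure_pmf.prob (pmf_of_set (cube d)) (cube d \<inter> {x. f x \<noteq> g x})"
      unfolding disagreement_def
      by (rule measure_pmf.finite_measure_eq_AE)
        (auto simp: AE_measure_pmf_iff finite_cube cube_nonempty)
    ultimately show "r \<in> measure_pmf.prob (pmf_of_set (cube d)) ` Pow (cube d)"
      by auto
  qed
qed (simp add: finite_cube)

lemma disagreements_nonempty: "{disagreement d f g | g. mono_on (cube d) g} \<noteq> {}"
proof -
  have "mono_on (cube d) (\<lambda>_. 0 :: real)" by (simp add: monotone_on_def)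
  then show ?thesis by blast
qed

definition far_from_mono :: "nat \<Rightarrow> real \<Rightarrow> (point \<Rightarrow> real) \<Rightarrow> bool" where
  "far_from_mono d \<alpha> f \<longleftrightarrow> dist_mono d f \<ge> \<alpha>"

text \<open>
  A deterministic (in general adaptive) oracle algorithm is a decision tree: it either stops with
  an output or queries a point and continues depending on the answer. A randomized algorithm is a
  probability distribution over deterministic ones; the parameters \<open>d\<close> and \<open>\<alpha>\<close>
  are ordinary (non-oracle) inputs. Only queries are counted, not computation time.
\<close>

datatype query_alg = Output real | Query point "real \<Rightarrow> query_alg"

primrec run :: "query_alg \<Rightarrow> (point \<Rightarrow> real) \<Rightarrow> real" where
  "run (Output r) f = r"
| "run (Query x k) f = run (k (f x)) f"

primrec queries :: "query_alg \<Rightarrow> (point \<Rightarrow> real) \<Rightarrow> point list" where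
  "queries (Output r) f = []"
| "queries (Query x k) f = x # queries (k (f x)) f"

definition queries_in_cube :: "nat \<Rightarrow> query_alg pmf \<Rightarrow> bool" where
  "queries_in_cube d P \<longleftrightarrow> (\<forall>A \<in> set_pmf P. \<forall>f. set (queries A f) \<subseteq> cube d)"

text \<open>Once the random choices are fixed, the sequence of queries is the same for all oracles.\<close>

definition nonadaptive :: "query_alg pmf \<Rightarrow> bool" where
  "nonadaptive P \<longleftrightarrow> (\<forall>A \<in> set_pmf P. \<forall>f g. queries A f = queries A g)"

definition makes_at_most :: "query_alg pmf \<Rightarrow> real \<Rightarrow> bool" where
  "makes_at_most P q \<longleftrightarrow> (\<forall>A \<in> set_pmf P. \<forall>f. real (length (queries A f)) \<le> q)"

definition approx_algorithm :: "nat \<Rightarrow> real \<Rightarrow> (real \<Rightarrow> query_alg pmf) \<Rightarrow> bool" where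
  "approx_algorithm d c P \<longleftrightarrow>
     (\<forall>\<alpha>\<in>{0<..<1}. queries_in_cube d (P \<alpha>) \<and>
        (\<forall>f. far_from_mono d \<alpha> f \<longrightarrow>
           measure_pmf.prob (P \<alpha>)
             {A. dist_mono d f \<le> run A f \<and> run A f \<le> c * dist_mono d f} \<ge> 2 / 3))"

end

(*
  Call an edge of the cube violated if f strictly decreases along it, and list every violated edge at
  its endpoint of larger degree (number of violated edges), at both endpoints in case of a tie. Let
  N(x) be the set of edges listed at x, and W the sum over x of |N(x)| / deg(x). Giving each violated
  edge the inverse of its larger endpoint degree as weight yields a fractional matching, hence
  W <= 2 * 2^d eps(f). Moreover W / 2^d is the mean of a quantity that depends only on f near a random
  point, so it can be estimated by sampling nonadaptively.

  Conversely, 2^d eps(f) <= C sqrt(d) W: a robust directed Talagrand inequality, valid however the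
  edges are listed, gives 2^d eps(f) <= C sum_x sqrt |N(x)|. By Cauchy-Schwarz this sum is at most
  sqrt (W * sum_x deg(x)), and the sum of the degrees is at most 2 d W.

  The directed inequality for Boolean f compares f with its sorted versions. For a fixed point x, the
  value at x of f sorted along the coordinates in a set S is a Boolean function of S, to which the
  undirected robust inequality applies; sorting does not increase the sum of the sqrt |N(x)|. Hence f
  sorted along a random half of the coordinates is already close to being sorted. Iterating this on
  random halves of the remaining coordinates costs a geometric series. Real-valued f is reduced to
  Boolean functions with disjoint sets of violated edges by means of an extremal matching.
*)
theory Submission
  imports Defs "HOL-Library.Transitive_Closure_Table" "HOL-Combinatorics.Permutations"
begin

section \<open>A robust Talagrand inequality\<close>

text \<open>The norm of a nonzero vector is its inner product with its own normalisation. Testing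
  against unit vectors lets Minkowski's inequality be checked term by term.\<close>

lemma sqrt_le_if_unit_combinations_le:
  fixes Q D T :: real
  assumes "Q \<ge> 0" "D \<ge> 0"
    and *: "\<And>c s. c \<ge> 0 \<Longrightarrow> s \<ge> 0 \<Longrightarrow> c\<^sup>2 + s\<^sup>2 = 1
        \<Longrightarrow> c * Q + s * D \<le> T"
  shows "sqrt (Q\<^sup>2 + D\<^sup>2) \<le> T"
proof (cases "Q\<^sup>2 + D\<^sup>2 = 0")
  case True
  then show ?thesis using *[of 1 0] assms(1) by simp
next
  case False
  define R where "R = sqrt (Q\<^sup>2 + D\<^sup>2)"
  have R2: "R\<^sup>2 = Q\<^sup>2 + D\<^sup>2" and R0: "R > 0"
    using False by (auto simp: R_def sum_power2_gt_zero_iff)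
  have "(Q / R)\<^sup>2 + (D / R)\<^sup>2 = 1"
    using R2 R0 False by (simp add: power_divide flip: add_divide_distrib)
  then have "Q / R * Q + D / R * D \<le> T"
    using assms(1,2) R0 by (intro *) auto
  moreover have "Q / R * Q + D / R * D = R"
    using R0 R2 by (simp add: field_simps power2_eq_square)
  ultimately show ?thesis by (simp add: R_def)
qed

lemma unit_combination_le_sqrt:
  fixes c s a b :: real
  assumes "c \<ge> 0" "s \<ge> 0" "c\<^sup>2 + s\<^sup>2 = 1" "a \<ge> 0" "b \<ge> 0"
  shows "c * a + s * b \<le> sqrt (a\<^sup>2 + b\<^sup>2)"
proof (rule real_le_rsqrt)
  have "(c\<^sup>2 + s\<^sup>2) * (a\<^sup>2 + b\<^sup>2) - (c * a + s * b)\<^sup>2 = (c * b - s * a)\<^sup>2"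
    by (simp add: power2_eq_square algebra_simps)
  then show "(c * a + s * b)\<^sup>2 \<le> a\<^sup>2 + b\<^sup>2"
    using assms(3) by (metis diff_ge_0_iff_ge mult_1 zero_le_power2)
qed

text \<open>With mean \<open>a\<close> and half-difference \<open>h\<close>, squaring reduces the
  claim to \<open>16 * (a * (1 - a)) * h\<^sup>2 \<le> 8 * (h\<^sup>2)\<^sup>2 + 4 *
  h\<^sup>2\<close>, which follows from \<open>a * (1 - a) \<le> 1 / 4\<close>. The case of small
  \<open>h\<close> at \<open>a = 1 / 2\<close> shows that no factor larger than
  \<open>sqrt 2\<close> would do.\<close>

lemma two_point_inequality:
  fixes u v :: real
  assumes "0 \<le> u" "u \<le> 1" "0 \<le> v" "v \<le> 1"
  shows "2 * (sqrt 2 * ((u + v) / 2) * (1 - (u + v) / 2))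
    \<le> sqrt ((sqrt 2 * (u * (1 - u) + v * (1 - v)))\<^sup>2 + \<bar>u - v\<bar>\<^sup>2)"
proof (rule real_le_rsqrt)
  define a h where "a = (u + v) / 2" and "h = (u - v) / 2"
  have uv: "u = a + h" "v = a - h" by (auto simp: a_def h_def field_simps)
  have "a * (1 - a) \<le> 1 / 4" 
  proof -
    have "0 \<le> (a - 1 / 2)\<^sup>2" by simp
    then show ?thesis by (simp add: power2_eq_square algebra_simps)
  qed
  then have "16 * (a * (1 - a)) * h\<^sup>2 \<le> 4 * h\<^sup>2"
    by (intro mult_right_mono) auto
  moreover have "0 \<le> 8 * (h\<^sup>2)\<^sup>2" by simp
  ultimately have "8 * (a * (1 - a))\<^sup>2 \<le> 8 * (a * (1 - a) - h\<^sup>2)\<^sup>2 + 4 * h\<^sup>2"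
    by (simp add: power2_eq_square algebra_simps)
  moreover have "(2 * (sqrt 2 * a * (1 - a)))\<^sup>2 = 8 * (a * (1 - a))\<^sup>2"
    by (simp add: power_mult_distrib)
  moreover have "u * (1 - u) + v * (1 - v) = 2 * (a * (1 - a) - h\<^sup>2)"
    unfolding uv by (simp add: power2_eq_square algebra_simps)
  then have "(sqrt 2 * (u * (1 - u) + v * (1 - v)))\<^sup>2 = 8 * (a * (1 - a) - h\<^sup>2)\<^sup>2"
    by (simp only: power_mult_distrib) simp
  moreover have "\<bar>u - v\<bar>\<^sup>2 = 4 * h\<^sup>2"
    unfolding uv by (simp add: power2_eq_square algebra_simps)
  ultimately show "(2 * (sqrt 2 * ((u + v) / 2) * (1 - (u + v) / 2)))\<^sup>2
    \<le> (sqrt 2 * (u * (1 - u) + v * (1 - v)))\<^sup>2 + \<bar>u - v\<bar>\<^sup>2"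
    unfolding a_def[symmetric] by simp
qed

lemma sum_Pow_insert:
  assumes "finite A" "a \<notin> A"
  shows "(\<Sum>S\<in>Pow (insert a A). F S) = (\<Sum>S\<in>Pow A. F S) + (\<Sum>S\<in>Pow A. F (insert a S))"
proof -
  have "inj_on (insert a) (Pow A)" using assms by (auto simp: inj_on_def)
  then show ?thesis
    using assms by (subst Pow_insert, subst sum.union_disjoint) (auto simp: sum.reindex)
qed

definition true_density :: "'a set \<Rightarrow> ('a set \<Rightarrow> bool) \<Rightarrow> real" where
  "true_density A g = (\<Sum>S\<in>Pow A. of_bool (g S)) / 2 ^ card A"

lemma true_density_bounds:
  assumes "finite A"
  shows "0 \<le> true_density A g" "true_density A g \<le> 1"
proof -
  show "0 \<le> true_density A g" by (simp add: true_density_def sum_nonneg)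
  have "(\<Sum>S\<in>Pow A. of_bool (g S)) \<le> (\<Sum>S\<in>Pow A. 1 :: real)" by (intro sum_mono) auto
  then show "true_density A g \<le> 1" using assms by (simp add: true_density_def card_Pow)
qed

text \<open>By Minkowski's inequality, the
  induction step only depends on the densities of the two halves and on how often they differ.\<close>

theorem talagrand_covered:
  assumes "finite A"
    and "\<And>S i. S \<subseteq> A \<Longrightarrow> i \<in> A \<Longrightarrow> i \<notin> S
        \<Longrightarrow> g S \<noteq> g (insert i S) \<Longrightarrow> i \<in> N S \<union> N (insert i S)"
  shows "2 ^ card A * (sqrt 2 * true_density A g * (1 - true_density A g))
    \<le> (\<Sum>S\<in>Pow A. sqrt (real (card (N S \<inter> A))))"
  using assms
proof (induction A arbitrary: g N)
  case empty
  then show ?case by (cases "g {}") (auto simp: true_density_def)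
next
  case (insert a A)
  define n :: real where "n = 2 ^ card A"
  define g' N' where "g' = (\<lambda>S. g (insert a S))" and "N' = (\<lambda>S. N (insert a S))"
  define u v where "u = true_density A g" and "v = true_density A g'"
  note bounds = true_density_bounds[OF insert.hyps(1), of g, folded u_def]
    true_density_bounds[OF insert.hyps(1), of g', folded v_def]
  define Q where "Q = sqrt 2 * (u * (1 - u) + v * (1 - v))"
  define X where "X = (\<Sum>S\<in>Pow A. sqrt (real (card (N S \<inter> A))))"
  define X' where "X' = (\<Sum>S\<in>Pow A. sqrt (real (card (N' S \<inter> A))))"
  define T where "T = (\<Sum>S\<in>Pow (insert a A). sqrt (real (card (N S \<inter> insert a A))))"
  define d0 where "d0 = (\<Sum>S\<in>Pow A. of_bool (a \<in> N S) :: real)"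
  define d1 where "d1 = (\<Sum>S\<in>Pow A. of_bool (a \<in> N' S) :: real)"
  have n0: "n > 0" by (simp add: n_def)
  have "n * (sqrt 2 * u * (1 - u)) \<le> X"
    unfolding n_def u_def X_def by (rule insert.IH) (use insert.prems in blast)
  moreover have "n * (sqrt 2 * v * (1 - v)) \<le> X'"
    unfolding n_def v_def X'_def
  proof (rule insert.IH)
    fix S i assume "S \<subseteq> A" "i \<in> A" "i \<notin> S" "g' S \<noteq> g' (insert i S)"
    then show "i \<in> N' S \<union> N' (insert i S)"
      using insert.prems[of "insert a S" i] insert.hyps(2)
      by (auto simp: g'_def N'_def insert_commute)
  qed
  ultimately have XQ: "n * Q \<le> X + X'" by (simp add: Q_def algebra_simps)
  \<comment> \<open>Wherever \<open>g\<close> and \<open>g'\<close> differ, the edge in direction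
    \<open>a\<close> is marked at one of its ends, so the densities differ by at most the number of
    marks \<open>a\<close>, up to scaling.\<close>
  have "\<bar>n * u - n * v\<bar> = \<bar>\<Sum>S\<in>Pow A. of_bool (g S) - (of_bool (g' S) :: real)\<bar>"
    using n0 by (simp add: u_def v_def true_density_def n_def sum_subtractf)
  also have "\<dots> \<le> (\<Sum>S\<in>Pow A. \<bar>of_bool (g S) - (of_bool (g' S) :: real)\<bar>)"
    by (rule sum_abs)
  also have "\<dots> \<le> (\<Sum>S\<in>Pow A. of_bool (a \<in> N S) + of_bool (a \<in> N' S))"
  proof (rule sum_mono)
    fix S assume "S \<in> Pow A"
    then show "\<bar>of_bool (g S) - (of_bool (g' S) :: real)\<bar>
        \<le> of_bool (a \<in> N S) + of_bool (a \<in> N' S)"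
      using insert.prems[of S a] insert.hyps(2) by (auto simp: g'_def N'_def)
  qed
  also have "\<dots> = d0 + d1" by (simp add: d0_def d1_def sum.distrib)
  finally have dd: "n * \<bar>u - v\<bar> \<le> d0 + d1"
    using n0 by (simp add: abs_mult flip: right_diff_distrib)
  \<comment> \<open>For a fixed unit vector the bound holds for each set separately by
    Cauchy-Schwarz; the best unit vector is chosen only after summation.\<close>
  have "c * (n * Q) + s * (n * \<bar>u - v\<bar>)
      \<le> T" if cs: "c \<ge> 0" "s \<ge> 0" "c\<^sup>2 + s\<^sup>2 = 1" for c s
  proof -
    have one: "c * sqrt (real (card (B \<inter> A))) + s * of_bool (a \<in> B)
        \<le> sqrt (real (card (B \<inter> insert a A)))" for B
    proof -
      have "real (card (B \<inter> insert a A)) = real (card (B \<inter> A)) + of_bool (a \<in> B)"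
        using insert.hyps by (auto simp: Int_insert_right)
      then show ?thesis
        using unit_combination_le_sqrt[OF cs, of "sqrt (real (card (B \<inter> A)))" "of_bool (a \<in> B)"]
        by auto
    qed
    have "c * (n * Q) + s * (n * \<bar>u - v\<bar>) \<le> c * (X + X') + s * (d0 + d1)"
      using XQ dd cs by (intro add_mono mult_left_mono) auto
    also have "\<dots> = (\<Sum>S\<in>Pow A. c * sqrt (real (card (N S \<inter> A))) + s * of_bool (a \<in> N S))
        + (\<Sum>S\<in>Pow A. c * sqrt (real (card (N' S \<inter> A))) + s * of_bool (a \<in> N' S))"
      by (simp only: X_def X'_def d0_def d1_def sum.distrib sum_distrib_left distrib_left) 
    also have "\<dots> \<le> T"
      unfolding T_def sum_Pow_insert[OF insert.hyps] N'_def
      by (intro add_mono sum_mono one)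
    finally show ?thesis .
  qed
  then have "sqrt ((n * Q)\<^sup>2 + (n * \<bar>u - v\<bar>)\<^sup>2) \<le> T"
    using n0 bounds by (intro sqrt_le_if_unit_combinations_le) (auto simp: Q_def)
  moreover have "sqrt ((n * Q)\<^sup>2 + (n * \<bar>u - v\<bar>)\<^sup>2)
      = n * sqrt (Q\<^sup>2 + \<bar>u - v\<bar>\<^sup>2)"
    using n0 by (simp add: power_mult_distrib real_sqrt_mult flip: distrib_left)
  moreover have "n * (2 * (sqrt 2 * ((u + v) / 2) * (1 - (u + v) / 2)))
      \<le> n * sqrt (Q\<^sup>2 + \<bar>u - v\<bar>\<^sup>2)"
    using two_point_inequality[OF bounds] n0 by (simp add: Q_def)
  moreover have "true_density (insert a A) g = (u + v) / 2"
    using insert.hyps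
    by (simp add: true_density_def u_def v_def g'_def sum_Pow_insert add_divide_distrib
        del: sum_of_bool_eq)
  ultimately have "n * (2 * (sqrt 2 * true_density (insert a A) g * (1 - true_density (insert a A) g))) \<le> T"
    by (metis order_trans)
  then show ?case
    using insert.hyps by (simp add: T_def n_def)
qed

section \<open>Sorting along coordinates\<close>

abbreviation flip :: "nat \<Rightarrow> point \<Rightarrow> point" where
  "flip i x \<equiv> x(i := 1 - x i)"

lemma cube_upd [simp]: "x \<in> cube d \<Longrightarrow> i < d \<Longrightarrow> b
    \<le> 1 \<Longrightarrow> x(i := b) \<in> cube d"
  by (auto simp: cube_def PiE_iff extensional_def)

lemma cube_coord: "x \<in> cube d \<Longrightarrow> i < d \<Longrightarrow> x i = 0 \<or> x i = 1"
  by (auto simp: cube_def PiE_iff)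

lemma card_cube: "card (cube d) = 2 ^ d"
  by (simp add: cube_def card_PiE numeral_2_eq_2)

lemma flip_bij: 
  assumes "i < d" shows "bij_betw (flip i) (cube d) (cube d)"
proof (rule bij_betw_byWitness[where f' = "flip i"])
  show "\<forall>x\<in>cube d. flip i (flip i x) = x"
    using cube_coord[OF _ assms] by fastforce
  then show "\<forall>x\<in>cube d. flip i (flip i x) = x" .
qed (use assms in auto)

lemma sum_flip:
  assumes "i < d" shows "(\<Sum>x\<in>cube d. F (flip i x)) = (\<Sum>x\<in>cube d. F x)"
  using sum.reindex_bij_betw[OF flip_bij[OF assms]] .

text \<open>Pairing each point with its flip in direction \<open>i\<close> counts both sums twice,
  so comparing them edge by edge suffices.\<close>

lemma sum_cube_mono_pairs:
  fixes F G :: "point \<Rightarrow> real"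
  assumes "i < d"
    and *: "\<And>x. x \<in> cube d \<Longrightarrow> F (x(i := 0)) + F (x(i := 1))
        \<le> G (x(i := 0)) + G (x(i := 1))"
  shows "(\<Sum>x\<in>cube d. F x) \<le> (\<Sum>x\<in>cube d. G x)"
proof -
  have double: "2 * (\<Sum>x\<in>cube d. H x) = (\<Sum>x\<in>cube d. H (x(i := 0)) + H (x(i := 1)))"
    for H :: "point \<Rightarrow> real"
  proof -
    have "2 * (\<Sum>x\<in>cube d. H x) = (\<Sum>x\<in>cube d. H x + H (flip i x))"
      using sum_flip[OF assms(1), of H] by (simp add: sum.distrib)
    also have "\<dots> = (\<Sum>x\<in>cube d. H (x(i := 0)) + H (x(i := 1)))"
    proof (rule sum.cong[OF refl])
      fix x assume "x \<in> cube d"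
      then have "x i = 0 \<or> x i = 1" using cube_coord assms(1) by blast
      then show "H x + H (flip i x) = H (x(i := 0)) + H (x(i := 1))"
        by (metis add.commute diff_self_eq_0 diff_zero fun_upd_triv)
    qed
    finally show ?thesis .
  qed
  have "2 * (\<Sum>x\<in>cube d. F x) \<le> 2 * (\<Sum>x\<in>cube d. G x)"
    unfolding double by (intro sum_mono *)
  then show ?thesis by simp
qed

definition srt :: "nat \<Rightarrow> (point \<Rightarrow> bool) \<Rightarrow> point \<Rightarrow> bool" where
  "srt i h x = (if x i = 1 then h (x(i := 0)) \<or> h (x(i := 1)) else h (x(i := 0)) \<and> h (x(i := 1)))"

definition mono_along :: "nat \<Rightarrow> nat \<Rightarrow> (point \<Rightarrow> bool) \<Rightarrow> bool" where
  "mono_along d i h \<longleftrightarrow> (\<forall>x\<in>cube d. h (x(i := 0)) \<longrightarrow> h (x(i := 1)))"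

section \<open>Hamming distance of Boolean functions under sorting\<close>

definition hdist :: "nat \<Rightarrow> (point \<Rightarrow> bool) \<Rightarrow>
    (point \<Rightarrow> bool) \<Rightarrow> real" where
  "hdist d g h = (\<Sum>x\<in>cube d. of_bool (g x \<noteq> h x))"

lemma hdist_commute: "hdist d g h = hdist d h g"
  by (auto simp: hdist_def intro!: sum.cong)

lemma hdist_triangle: "hdist d f h \<le> hdist d f g + hdist d g h"
  unfolding hdist_def sum.distrib[symmetric] by (intro sum_mono) auto

lemma hdist_le: "hdist d f g \<le> 2 ^ d"
proof -
  have "hdist d f g \<le> (\<Sum>x\<in>cube d. 1)" unfolding hdist_def by (intro sum_mono) auto
  then show ?thesis by (simp add: card_cube)
qed

lemma srt_upd: "srt i h (x(i := b)) = (if b = 1 then h (x(i := 0)) \<or> h (x(i := 1)) else h (x(i := 0))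
    \<and> h (x(i := 1)))"
  by (simp add: srt_def)

text \<open>After sorting, the number of disagreements on an edge is the difference of the two
  numbers of true values, which never exceeds the number of disagreements before.\<close>

lemma hdist_srt_le:
  assumes "i < d" shows "hdist d (srt i g) (srt i h) \<le> hdist d g h"
  unfolding hdist_def
  by (rule sum_cube_mono_pairs[OF assms]) (auto simp: srt_upd)

lemma mono_along_srt_self: "mono_along d i (srt i h)"
  by (auto simp: mono_along_def srt_upd)

text \<open>Conjunction and disjunction preserve implications, so sorting along \<open>j\<close>
  does not spoil the order achieved along \<open>i\<close>.\<close>

lemma mono_along_srt:
  assumes "mono_along d i h" "j < d"
  shows "mono_along d i (srt j h)"
proof (cases "i = j")
  case False
  have "h (x(j := b, i := 0)) \<Longrightarrow> h (x(j := b, i := 1))" if "x \<in> cube d" "b \<le> 1" for x b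
    using that cube_upd[of x d j b] assms unfolding mono_along_def by blast
  then show ?thesis using False
    unfolding mono_along_def srt_def by (auto simp: fun_upd_twist[OF False])
qed (simp add: mono_along_srt_self)

lemma srt_eq_if_mono_along:
  assumes "mono_along d i h" "i < d" "x \<in> cube d"
  shows "srt i h x = h x"
proof -
  have "x i = 0 \<or> x i = 1" using cube_coord assms by blast
  moreover have "h (x(i := 0)) \<longrightarrow> h (x(i := 1))" using assms by (auto simp: mono_along_def)
  ultimately show ?thesis unfolding srt_def by (metis fun_upd_triv zero_neq_one)
qed

lemma hdist_fold_srt_le:
  assumes "set js \<subseteq> {..<d}"
  shows "hdist d (fold srt js g) (fold srt js h) \<le> hdist d g h"
  using assms
proof (induction js arbitrary: g h)
  case (Cons j js)
  then have "hdist d (fold srt js (srt j g)) (fold srt js (srt j h)) \<le> hdist d (srt j g) (srt j h)"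
    by simp
  then show ?case using hdist_srt_le[of j d g h] Cons.prems by simp
qed simp

lemma mono_along_fold_srt:
  assumes "set js \<subseteq> {..<d}" "i \<in> set js \<or> mono_along d i h"
  shows "mono_along d i (fold srt js h)"
  using assms
proof (induction js arbitrary: h)
  case (Cons j js)
  then show ?case using mono_along_srt[of d i h j] mono_along_srt_self[of d j h] by auto
qed simp

text \<open>Sorting fixes such a function only on the cube, so this is phrased as distance zero and
  carried through the list by contraction.\<close>

lemma hdist_fold_srt_self:
  assumes "set js \<subseteq> {..<d}" "\<And>j. j \<in> set js \<Longrightarrow> mono_along d j h"
  shows "hdist d (fold srt js h) h = 0"
  using assms
proof (induction js)
  case (Cons j js)
  have "hdist d (srt j h) h = 0"
    using Cons.prems srt_eq_if_mono_along[of d j h] by (auto simp: hdist_def intro!: sum.neutral)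
  moreover have "hdist d (fold srt js (srt j h)) (fold srt js h) \<le> hdist d (srt j h) h"
    using Cons.prems by (intro hdist_fold_srt_le) auto
  moreover have "hdist d (fold srt js h) h = 0" using Cons by auto
  moreover have "0 \<le> hdist d (fold srt js (srt j h)) h" by (simp add: hdist_def sum_nonneg)
  ultimately show ?case
    using hdist_triangle[of d "fold srt js (srt j h)" h "fold srt js h"] by simp
qed (simp add: hdist_def)

text \<open>Moving from \<open>x\<close> to \<open>y\<close>, the coordinates are replaced one at a
  time, each step following an edge upwards or standing still.\<close>

lemma mono_if_mono_along:
  assumes "\<And>i. i < d \<Longrightarrow> mono_along d i h" "x \<in> cube d" "y \<in> cube d" "x \<le> y" "h x"
  shows "h y"
proof -
  have "h (\<lambda>i. if i < k then y i else x i)" if "k \<le> d" for k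
    using that
  proof (induction k)
    case (Suc k)
    define z where "z = (\<lambda>i. if i < k then y i else x i)"
    have z: "z \<in> cube d" using assms(2,3) by (auto simp: z_def cube_def PiE_iff extensional_def)
    have hz: "h z" using Suc by (simp add: z_def)
    have eq: "(\<lambda>i. if i < Suc k then y i else x i) = z(k := y k)"
      by (auto simp: z_def less_Suc_eq)
    have "x k = z k" by (simp add: z_def)
    have xy: "x k \<le> y k" using assms(4) by (simp add: le_fun_def)
    have c: "x k = 0 \<or> x k = 1" "y k = 0 \<or> y k = 1"
      using cube_coord assms(2,3) Suc.prems by auto
    show ?case
    proof (cases "x k = y k")
      case True
      then have "z(k := y k) = z" using \<open>x k = z k\<close> by (metis fun_upd_triv)
      then show ?thesis using hz eq by simp
    next
      case False
      then have "x k = 0" "y k = 1" using xy c by auto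
      then show ?thesis
        using assms(1)[of k] Suc.prems z hz eq \<open>x k = z k\<close> unfolding mono_along_def
        by (metis Suc_le_eq fun_upd_triv)
    qed
  qed (use assms in simp)
  from this[of d] have "h (\<lambda>i. if i < d then y i else x i)" by simp
  moreover have "(\<lambda>i. if i < d then y i else x i) = y"
    using assms(2,3) by (auto simp: cube_def PiE_iff extensional_def)
  ultimately show ?thesis by simp
qed

text \<open>The new marks when \<open>h\<close> is sorted along \<open>i\<close>. If the two values are swapped, the
  marks move along with them. If they are equal, violated edges to swapped neighbours end up at one
  known side, which receives the union of the marks while the other side keeps the intersection:
  this preserves the total number of marks and makes their distribution more uneven.\<close>

definition marks :: "nat \<Rightarrow> (point \<Rightarrow> bool) \<Rightarrow>
    (point \<Rightarrow> nat set) \<Rightarrow> point \<Rightarrow> nat set" where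
  "marks i h N x = (let A = N (x(i := 0)); B = N (x(i := 1)) in
     if h (x(i := 0)) then
       if h (x(i := 1)) then (if x i = 1 then A \<inter> B else A \<union> B)
       else (if x i = 1 then A else B)
     else
       if h (x(i := 1)) then (if x i = 1 then B else A)
       else (if x i = 1 then A \<union> B else A \<inter> B))"

lemma marks_upd: "marks i h N (x(i := b)) = (let A = N (x(i := 0)); B = N (x(i := 1)) in
     if h (x(i := 0)) then
       if h (x(i := 1)) then (if b = 1 then A \<inter> B else A \<union> B)
       else (if b = 1 then A else B)
     else
       if h (x(i := 1)) then (if b = 1 then B else A)
       else (if b = 1 then A \<union> B else A \<inter> B))"
  unfolding marks_def fun_upd_upd fun_upd_same ..

text \<open>With equal sums, the pair \<open>x\<close>, \<open>y\<close> is spread more widely than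
  \<open>a\<close>, \<open>b\<close> and thus has the smaller product; this compares the squares of
  both sides.\<close>

lemma sqrt_add_le_if_spread:
  fixes a b x y :: real
  assumes "a + b = x + y" "0 \<le> y" "y \<le> a" "y \<le> b"
  shows "sqrt x + sqrt y \<le> sqrt a + sqrt b"
proof (rule power2_le_imp_le)
  have "(a - y) * (b - y) \<ge> 0" using assms by simp
  moreover have "x = a + b - y" using assms(1) by simp
  ultimately have "x * y \<le> a * b" by (simp only:) (simp add: algebra_simps)
  then have "sqrt x * sqrt y \<le> sqrt a * sqrt b" by (simp flip: real_sqrt_mult)
  then show "(sqrt x + sqrt y)\<^sup>2 \<le> (sqrt a + sqrt b)\<^sup>2"
    using assms by (simp add: power2_sum)
qed (use assms in auto)

lemma sqrt_card_Un_Int: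
  assumes "finite A" "finite B"
  shows "sqrt (real (card (A \<union> B))) + sqrt (real (card (A \<inter> B)))
      \<le> sqrt (real (card A)) + sqrt (real (card B))"
proof (rule sqrt_add_le_if_spread)
  show "real (card A) + real (card B) = real (card (A \<union> B)) + real (card (A \<inter> B))"
    using card_Un_Int[OF assms] by linarith
qed (use assms in \<open>auto intro!: card_mono\<close>)

lemma sum_sqrt_marks_le:
  assumes "i < d" "\<And>x. x \<in> cube d \<Longrightarrow> finite (N x)"
  shows "(\<Sum>x\<in>cube d. sqrt (real (card (marks i h N x))))
      \<le> (\<Sum>x\<in>cube d. sqrt (real (card (N x))))"
proof (rule sum_cube_mono_pairs[OF assms(1)])
  fix x assume "x \<in> cube d"
  then have "finite (N (x(i := 0)))" "finite (N (x(i := 1)))"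
    by (intro assms(2) cube_upd assms(1); simp)+
  from sqrt_card_Un_Int[OF this] show "sqrt (real (card (marks i h N (x(i := 0)))))
      + sqrt (real (card (marks i h N (x(i := 1)))))
    \<le> sqrt (real (card (N (x(i := 0))))) + sqrt (real (card (N (x(i := 1)))))"
    by (simp add: marks_upd Let_def)
qed

section \<open>Covering invariants of marked functions\<close>

type_synonym marked = "(point \<Rightarrow> bool) \<times> (point \<Rightarrow> nat set)"

definition msrt :: "nat \<Rightarrow> marked \<Rightarrow> marked" where
  "msrt i s = (srt i (fst s), marks i (fst s) (snd s))"

lemma fst_fold_msrt: "fst (fold msrt js s) = fold srt js (fst s)"
  by (induction js arbitrary: s) (auto simp: msrt_def)

lemma marks_subset: 
  assumes "i < d" "\<And>x. x \<in> cube d \<Longrightarrow> N x \<subseteq> A" "x \<in> cube d"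
  shows "marks i h N x \<subseteq> A"
proof -
  have "N (x(i := 0)) \<subseteq> A" "N (x(i := 1)) \<subseteq> A" by (intro assms(2) cube_upd assms; simp)+
  then show ?thesis by (auto simp: marks_def Let_def)
qed

lemma fold_msrt_potential:
  assumes "set js \<subseteq> {..<d}" "finite A" "\<And>x. x \<in> cube d \<Longrightarrow> snd s x \<subseteq> A"
  shows "(\<Sum>x\<in>cube d. sqrt (real (card (snd (fold msrt js s) x))))
      \<le> (\<Sum>x\<in>cube d. sqrt (real (card (snd s x))))"
  using assms
proof (induction js arbitrary: s)
  case (Cons j js)
  have "(\<Sum>x\<in>cube d. sqrt (real (card (snd (fold msrt js (msrt j s)) x))))
      \<le> (\<Sum>x\<in>cube d. sqrt (real (card (snd (msrt j s) x))))"
    using Cons.prems marks_subset[of j d "snd s" A]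
    by (intro Cons.IH) (auto simp: msrt_def)
  also have "\<dots> \<le> (\<Sum>x\<in>cube d. sqrt (real (card (snd s x))))"
    using Cons.prems by (auto simp: msrt_def intro!: sum_sqrt_marks_le intro: finite_subset)
  finally show ?case by simp
qed simp

lemma fold_msrt_subset:
  assumes "set js \<subseteq> {..<d}" "\<And>x. x \<in> cube d
      \<Longrightarrow> snd s x \<subseteq> A" "x \<in> cube d"
  shows "snd (fold msrt js s) x \<subseteq> A"
  using assms
proof (induction js arbitrary: s)
  case (Cons j js)
  then show ?case using marks_subset[of j d "snd s" A] by (auto simp: msrt_def)
qed simp

text \<open>Two marked functions sorted along \<open>S\<close> and along \<open>insert i S\<close> agree until coordinate \<open>i\<close> is
  processed. At that moment the violated edges in direction \<open>i\<close> turn into the points where the two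
  functions differ, and a mark \<open>i\<close> at either endpoint provides one for both points: the
  unsorted function keeps it, and the sorted one has moved it to the other point.\<close>

definition covers_diff :: "nat \<Rightarrow> nat \<Rightarrow> marked \<Rightarrow> marked \<Rightarrow> bool" where
  "covers_diff d i s t \<longleftrightarrow>
      (\<forall>x\<in>cube d. fst s x \<noteq> fst t x \<longrightarrow> i \<in> snd s x \<union> snd t x)"

definition covers_viol :: "nat \<Rightarrow> nat \<Rightarrow> marked \<Rightarrow> bool" where
  "covers_viol d i s \<longleftrightarrow> (\<forall>x\<in>cube d. fst s (x(i := 0))
      \<and> \<not> fst s (x(i := 1)) \<longrightarrow>
     i \<in> snd s (x(i := 0)) \<union> snd s (x(i := 1)))"

text \<open>On an edge in direction \<open>j\<close>, a constant pair of values can differ from a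
  sorted nonconstant pair at one end only, and that end holds the union. Opposite constant pairs
  differ at both ends: if neither mark of one function contains \<open>i\<close>, then both marks of
  the other do, and so does their intersection.\<close>

lemma covers_diff_msrt:
  assumes "covers_diff d i s t" "j < d"
  shows "covers_diff d i (msrt j s) (msrt j t)"
  unfolding covers_diff_def
proof (intro ballI)
  fix x assume "x \<in> cube d"
  then have "x(j := 0) \<in> cube d" "x(j := 1) \<in> cube d" using assms(2) by auto
  then have "fst s (x(j := 0)) \<noteq> fst t (x(j := 0)) \<longrightarrow> i \<in> snd s
      (x(j := 0)) \<union> snd t (x(j := 0))"
    "fst s (x(j := 1)) \<noteq> fst t (x(j := 1)) \<longrightarrow> i \<in> snd s (x(j := 1)) \<union> snd t
        (x(j := 1))"
    using assms(1) by (auto simp: covers_diff_def)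
  then show "fst (msrt j s) x \<noteq> fst (msrt j t) x \<longrightarrow> i \<in> snd (msrt j s) x \<union> snd
      (msrt j t) x"
    by (auto simp: msrt_def srt_def marks_def Let_def)
qed

lemma covers_diff_fold_msrt:
  assumes "covers_diff d i s t" "set js \<subseteq> {..<d}"
  shows "covers_diff d i (fold msrt js s) (fold msrt js t)"
  using assms by (induction js arbitrary: s t) (auto simp: covers_diff_msrt)

text \<open>The same case analysis applies to the square in directions \<open>i\<close> and
  \<open>j\<close>, its two sides in direction \<open>j\<close> taking the place of the two
  functions.\<close>

lemma covers_viol_msrt:
  assumes "covers_viol d i s" "j < d" "i \<noteq> j"
  shows "covers_viol d i (msrt j s)"
  unfolding covers_viol_def
proof (intro ballI)
  fix x assume "x \<in> cube d"
  then have "x(j := 0) \<in> cube d" "x(j := 1) \<in> cube d" using assms(2) by auto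
  then have "fst s (x(j := 0, i := 0)) \<and> \<not> fst s (x(j := 0, i := 1)) \<longrightarrow> 
      i \<in> snd s (x(j := 0, i := 0)) \<union> snd s (x(j := 0, i := 1))"
    "fst s (x(j := 1, i := 0)) \<and> \<not> fst s (x(j := 1, i := 1)) \<longrightarrow> 
      i \<in> snd s (x(j := 1, i := 0)) \<union> snd s (x(j := 1, i := 1))"
    using assms(1) unfolding covers_viol_def by blast+
  then show "fst (msrt j s) (x(i := 0)) \<and> \<not> fst (msrt j s) (x(i := 1)) \<longrightarrow>
      i \<in> snd (msrt j s) (x(i := 0)) \<union> snd (msrt j s) (x(i := 1))"
    using assms(3)
    by (auto simp: msrt_def srt_def marks_def Let_def fun_upd_twist[OF assms(3)] split: if_splits)
qed

lemma covers_viol_fold_msrt: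
  assumes "covers_viol d i s" "set js \<subseteq> {..<d}" "i \<notin> set js"
  shows "covers_viol d i (fold msrt js s)"
  using assms by (induction js arbitrary: s) (auto simp: covers_viol_msrt)

lemma covers_diff_msrt_self:
  assumes "covers_viol d i s" "i < d"
  shows "covers_diff d i s (msrt i s)"
  unfolding covers_diff_def
proof (intro ballI)
  fix x assume x: "x \<in> cube d"
  then have "fst s (x(i := 0))
      \<and> \<not> fst s (x(i := 1)) \<longrightarrow> i \<in> snd s (x(i := 0)) \<union> snd s (x(i := 1))"
    using assms unfolding covers_viol_def by blast
  moreover have "x = x(i := 0) \<and> x i = 0 \<or> x = x(i := 1) \<and> x i = 1"
    using cube_coord[OF x assms(2)] by auto
  ultimately show "fst s x \<noteq> fst (msrt i s) x \<longrightarrow> i \<in> snd s x \<union> snd (msrt i s) x"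
    by (cases "fst s (x(i := 0))"; cases "fst s (x(i := 1))"; auto simp: msrt_def srt_def marks_def Let_def)
qed

lemma covers_diff_filter:
  assumes "\<And>j. j \<in> set js
      \<Longrightarrow> covers_viol d j s" "distinct js" "set js \<subseteq> {..<d}" "i \<in> set js" "i \<notin> S"
  shows "covers_diff d i (fold msrt (filter (\<lambda>j. j \<in> S) js) s)
    (fold msrt (filter (\<lambda>j. j \<in> insert i S) js) s)"
proof -
  obtain as bs where js: "js = as @ i # bs" using assms(4) by (meson split_list)
  define u where "u = fold msrt (filter (\<lambda>j. j \<in> S) as) s"
  have cong: "filter (\<lambda>j. j \<in> insert i S) as = filter (\<lambda>j. j \<in> S) as"
    "filter (\<lambda>j. j \<in> insert i S) bs = filter (\<lambda>j. j \<in> S) bs"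
    using assms(2) js by (auto intro!: filter_cong)
  have "covers_viol d i u"
    unfolding u_def using assms js by (intro covers_viol_fold_msrt) auto
  then have "covers_diff d i u (msrt i u)" using assms by (intro covers_diff_msrt_self) auto
  then have "covers_diff d i (fold msrt (filter (\<lambda>j. j \<in> S) bs) u)
      (fold msrt (filter (\<lambda>j. j \<in> S) bs) (msrt i u))"
    using assms js by (intro covers_diff_fold_msrt) auto
  moreover have "fold msrt (filter (\<lambda>j. j \<in> S) js) s = fold msrt (filter (\<lambda>j. j \<in> S) bs) u"
    using assms(5) by (simp add: js u_def)
  moreover have "fold msrt (filter (\<lambda>j. j \<in> insert i S) js) s
      = fold msrt (filter (\<lambda>j. j \<in> S) bs) (msrt i u)"
    unfolding js u_def filter_append fold_append filter.simps cong by simp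
  ultimately show ?thesis by simp
qed

section \<open>The Boolean directed inequality\<close>

lemma sum_Pow_compl:
  assumes "finite A"
  shows "(\<Sum>S\<in>Pow A. F (A - S)) = (\<Sum>S\<in>Pow A. F S)"
  by (rule sum.reindex_bij_betw, rule bij_betw_byWitness[where f' = "\<lambda>S. A - S"]) auto

text \<open>A disagreement needs \<open>g\<close> to be true at one of the two sets and false at the
  other, so by symmetry its probability is at most \<open>2 * p\<close> and at most
  \<open>2 * (1 - p)\<close>. The smaller of these is at most
  \<open>4 * (p * (1 - p))\<close>.\<close>

lemma sum_compl_disagree_le:
  fixes g :: "'a set \<Rightarrow> bool"
  assumes "finite A"
  defines "p \<equiv> true_density A g"
  shows "(\<Sum>S\<in>Pow A. of_bool (g S \<noteq> g (A - S))) \<le> 2 ^ card A * (4 * (p * (1 - p)))"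
proof -
  have half: "(\<Sum>S\<in>Pow A. of_bool (k S \<noteq> k (A - S))) \<le> 2 ^ card A * (2 * true_density A k)"
    for k :: "'a set \<Rightarrow> bool"
  proof -
    have "(\<Sum>S\<in>Pow A. of_bool (k S \<noteq> k (A - S)) :: real)
        \<le> (\<Sum>S\<in>Pow A. of_bool (k S) + of_bool (k (A - S)))"
      by (intro sum_mono) auto
    also have "\<dots> = 2 * (\<Sum>S\<in>Pow A. of_bool (k S))"
      using sum_Pow_compl[OF assms(1), of "\<lambda>S. of_bool (k S) :: real"]
      by (simp add: sum.distrib del: sum_of_bool_eq)
    finally show ?thesis by (simp add: true_density_def del: sum_of_bool_eq)
  qed
  have compl: "true_density A (\<lambda>S. \<not> g S) = 1 - p"
  proof -
    have "(\<Sum>S\<in>Pow A. of_bool (\<not> g S) :: real) = (\<Sum>S\<in>Pow A. 1 - of_bool (g S))"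
      by (intro sum.cong) auto
    then show ?thesis
      using assms by (simp add: true_density_def sum_subtractf card_Pow diff_divide_distrib del: sum_of_bool_eq)
  qed
  have p: "0 \<le> p" "p \<le> 1" using true_density_bounds assms by auto
  show ?thesis
  proof (cases "p \<le> 1 / 2")
    case True
    then have "2 * p \<le> 4 * (p * (1 - p))" using p mult_left_mono[of p "1/2" p] by (simp add: algebra_simps)
    then show ?thesis
      using half[of g] unfolding p_def[symmetric]
      by (meson mult_left_mono order_trans zero_le_numeral zero_le_power)
  next
    case False
    then have "2 * (1 - p) \<le> 4 * (p * (1 - p))" 
      using p mult_right_mono[of "1/2" p "1 - p"] by simp
    then have "2 ^ card A * (2 * (1 - p)) \<le> 2 ^ card A * (4 * (p * (1 - p)))" by simp
    then show ?thesis
      using order_trans[OF half[of "\<lambda>S. \<not> g S", unfolded compl]] by (simp del: sum_of_bool_eq)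
  qed
qed

text \<open>For random \<open>S\<close> this is one inverse riffle shuffle. Both blocks keep their
  internal order, which is why it commutes with filters.\<close>

definition shuffle :: "nat set \<Rightarrow> nat list \<Rightarrow> nat list" where
  "shuffle S js = filter (\<lambda>j. j \<in> S) js @ filter (\<lambda>j. j \<notin> S) js"

lemma set_shuffle [simp]: "set (shuffle S js) = set js"
  by (auto simp: shuffle_def)

lemma distinct_shuffle [simp]: "distinct js \<Longrightarrow> distinct (shuffle S js)"
  by (auto simp: shuffle_def)

lemma filter_shuffle: "filter P (shuffle S js) = shuffle S (filter P js)"
  by (simp add: shuffle_def conj_commute)

text \<open>Either end may carry the mark, and further marks are allowed; this freedom is what makes
  the inequality applicable to the heavy directions.\<close>

locale viol_cover =
  fixes d :: nat and h :: "point \<Rightarrow> bool" and N :: "point \<Rightarrow> nat set"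
  assumes N_subset: "x \<in> cube d \<Longrightarrow> N x \<subseteq> {..<d}"
    and N_covers: "x \<in> cube d \<Longrightarrow> i < d \<Longrightarrow> h (x(i := 0))
        \<Longrightarrow> \<not> h (x(i := 1)) \<Longrightarrow>
      i \<in> N (x(i := 0)) \<union> N (x(i := 1))"
begin

text \<open>The restriction to the coordinates still to be sorted lets this quantity shrink when
  \<open>js\<close> is thinned out at random.\<close>

definition energy :: "nat list \<Rightarrow> real" where
  "energy js = (\<Sum>x\<in>cube d. sqrt (real (card (N x \<inter> set js))))"

abbreviation sorted_on :: "nat list \<Rightarrow> nat set \<Rightarrow> point \<Rightarrow> bool" where
  "sorted_on js S \<equiv> fold srt (filter (\<lambda>j. j \<in> S) js) h"

lemma energy_nonneg: "0 \<le> energy js"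
  by (simp add: energy_def sum_nonneg)

text \<open>At a fixed point the sorted value is a Boolean function of \<open>S\<close>, and the
  transported marks cover its changes, so \<open>talagrand_covered\<close> applies. After exchanging
  the sums, \<open>fold_msrt_potential\<close> bounds the marks for each \<open>S\<close> by those
  at the start.\<close>

lemma sum_variance_le_energy:
  assumes "distinct js" "set js \<subseteq> {..<d}"
  shows "sqrt 2 * (\<Sum>x\<in>cube d. true_density {..<d} (\<lambda>S. sorted_on js S x)
      * (1 - true_density {..<d} (\<lambda>S. sorted_on js S x))) \<le> energy js"
proof -
  define s :: marked where "s = (h, \<lambda>x. N x \<inter> set js)"
  define m where "m = (\<lambda>S. fold msrt (filter (\<lambda>j. j \<in> S) js) s)"
  have fst_m: "fst (m S) = sorted_on js S" for S
    by (simp add: m_def fst_fold_msrt s_def)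
  have sub: "snd (m S) x \<subseteq> {..<d}" if "x \<in> cube d" for S x
    unfolding m_def using assms N_subset that by (intro fold_msrt_subset[where d = d]) (auto simp: s_def)
  have "2 ^ d * (sqrt 2 * true_density {..<d} (\<lambda>S. sorted_on js S x)
      * (1 - true_density {..<d} (\<lambda>S. sorted_on js S x)))
      \<le> (\<Sum>S\<in>Pow {..<d}. sqrt (real (card (snd (m S) x))))" if x: "x \<in> cube d" for x
  proof -
    have "i \<in> snd (m S) x \<union> snd (m (insert i S)) x"
      if "i \<in> {..<d}" "i \<notin> S" "sorted_on js S x \<noteq> sorted_on js (insert i S) x" for S i
    proof (cases "i \<in> set js")
      case True
      have "covers_diff d i (m S) (m (insert i S))"
        unfolding m_def
      proof (rule covers_diff_filter)
        fix j assume "j \<in> set js"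
        then show "covers_viol d j s"
          using N_covers assms(2) by (force simp: covers_viol_def s_def)
      qed (use assms True that in auto)
      then show ?thesis using that x by (auto simp: covers_diff_def fst_m)
    next
      case False
      then have "filter (\<lambda>j. j \<in> insert i S) js = filter (\<lambda>j. j \<in> S) js"
        by (auto intro!: filter_cong)
      then show ?thesis using that by simp
    qed
    then have "2 ^ card {..<d} * (sqrt 2 * true_density {..<d} (\<lambda>S. sorted_on js S x)
      * (1 - true_density {..<d} (\<lambda>S. sorted_on js S x)))
      \<le> (\<Sum>S\<in>Pow {..<d}. sqrt (real (card (snd (m S) x \<inter> {..<d}))))"
      by (intro talagrand_covered) auto
    then show ?thesis using sub[OF x] by (simp add: Int_absorb2)
  qed
  then have "(\<Sum>x\<in>cube d. 2 ^ d * (sqrt 2 * true_density {..<d} (\<lambda>S. sorted_on js S x)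
      * (1 - true_density {..<d} (\<lambda>S. sorted_on js S x))))
      \<le> (\<Sum>x\<in>cube d. \<Sum>S\<in>Pow {..<d}. sqrt (real (card (snd (m S) x))))"
    by (rule sum_mono)
  also have "\<dots> = (\<Sum>S\<in>Pow {..<d}. \<Sum>x\<in>cube d. sqrt (real (card (snd (m S) x))))"
    by (rule sum.swap)
  also have "\<dots> \<le> (\<Sum>S\<in>Pow {..<d}. energy js)"
  proof (rule sum_mono)
    fix S
    have "(\<Sum>x\<in>cube d. sqrt (real (card (snd (m S) x))))
        \<le> (\<Sum>x\<in>cube d. sqrt (real (card (snd s x))))"
      unfolding m_def using assms
      by (intro fold_msrt_potential[where A = "set js"]) (auto simp: s_def)
    then show "(\<Sum>x\<in>cube d. sqrt (real (card (snd (m S) x)))) \<le> energy js"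
      by (simp add: s_def energy_def)
  qed
  finally show ?thesis
    by (simp add: card_Pow mult.assoc flip: sum_distrib_left)
qed

lemma sum_hdist_compl_le:
  assumes "distinct js" "set js \<subseteq> {..<d}"
  shows "(\<Sum>S\<in>Pow {..<d}. hdist d (sorted_on js S) (sorted_on js ({..<d} - S)))
      \<le> 2 ^ d * (2 * sqrt 2 * energy js)"
proof -
  let ?p = "\<lambda>x. true_density {..<d} (\<lambda>S. sorted_on js S x)"
  have "(\<Sum>S\<in>Pow {..<d}. hdist d (sorted_on js S) (sorted_on js ({..<d} - S)))
      = (\<Sum>x\<in>cube d. \<Sum>S\<in>Pow {..<d}. of_bool (sorted_on js S x \<noteq> sorted_on js ({..<d} - S) x))"
    unfolding hdist_def by (rule sum.swap)
  also have "\<dots> \<le> (\<Sum>x\<in>cube d. 2 ^ d * (4 * (?p x * (1 - ?p x))))"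
  proof (rule sum_mono)
    fix x
    show "(\<Sum>S\<in>Pow {..<d}. of_bool (sorted_on js S x \<noteq> sorted_on js ({..<d} - S) x))
        \<le> 2 ^ d * (4 * (?p x * (1 - ?p x)))"
      using sum_compl_disagree_le[of "{..<d}" "\<lambda>S. sorted_on js S x"] unfolding card_lessThan by blast
  qed
  also have "\<dots> = 2 ^ d * (2 * sqrt 2 * (sqrt 2 * (\<Sum>x\<in>cube d. ?p x * (1 - ?p x))))"
    by (simp flip: sum_distrib_left)
  also have "\<dots> \<le> 2 ^ d * (2 * sqrt 2 * energy js)"
    using sum_variance_le_energy[OF assms] by (intro mult_left_mono) auto
  finally show ?thesis .
qed

text \<open>Sorting \<open>h\<close> along \<open>S\<close> and along the complement gives nearby functions, the second of
  which is fixed by sorting along the complement.\<close>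

lemma sum_hdist_rest_le:
  assumes "distinct js" "set js \<subseteq> {..<d}"
  shows "(\<Sum>S\<in>Pow {..<d}. hdist d (sorted_on js S) (fold srt (filter (\<lambda>j. j \<notin> S) js)
      (sorted_on js S)))
    \<le> 2 ^ d * (4 * sqrt 2 * energy js)"
proof -
  have "hdist d (sorted_on js S) (fold srt (filter (\<lambda>j. j \<notin> S) js) (sorted_on js S))
      \<le> 2 * hdist d (sorted_on js S) (sorted_on js ({..<d} - S))" for S
  proof -
    define g where "g = sorted_on js S"
    define k where "k = sorted_on js ({..<d} - S)"
    define rs where "rs = filter (\<lambda>j. j \<notin> S) js"
    have rs: "set rs \<subseteq> {..<d}" using assms by (auto simp: rs_def)
    have "mono_along d j k" if "j \<in> set rs" for j
      unfolding k_def using that assms by (intro mono_along_fold_srt) (auto simp: rs_def)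
    then have "hdist d (fold srt rs k) k = 0" using rs by (intro hdist_fold_srt_self) auto
    \<comment> \<open>The distance between \<open>g\<close> and \<open>k\<close> is paid twice: once
      before and once after sorting along \<open>rs\<close>.\<close>
    moreover have "hdist d (fold srt rs k) (fold srt rs g) \<le> hdist d k g"
      using rs by (rule hdist_fold_srt_le)
    ultimately show ?thesis
      using hdist_triangle[of d g "fold srt rs g" k] hdist_triangle[of d k "fold srt rs g" "fold srt rs k"]
      unfolding g_def[symmetric] k_def[symmetric] rs_def[symmetric]
      by (simp add: hdist_commute)
  qed
  then have "(\<Sum>S\<in>Pow {..<d}. hdist d (sorted_on js S) (fold srt (filter (\<lambda>j. j \<notin> S) js)
      (sorted_on js S)))
    \<le> 2 * (\<Sum>S\<in>Pow {..<d}. hdist d (sorted_on js S) (sorted_on js ({..<d} - S)))"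
    by (subst sum_distrib_left) (intro sum_mono)
  then show ?thesis using sum_hdist_compl_le[OF assms] by simp
qed

text \<open>A set and its complement split \<open>B\<close> into two parts, and
  \<open>sqrt a + sqrt b \<le> sqrt 2 * sqrt (a + b)\<close>. Thus keeping a random half of the
  coordinates costs a factor \<open>1 / sqrt 2\<close> on average, which makes the later series
  geometric.\<close>

lemma sum_energy_filter_le:
  assumes "set js \<subseteq> {..<d}"
  shows "(\<Sum>T\<in>Pow {..<d}. energy (filter (\<lambda>j. j \<in> T) js)) \<le> 2 ^ d * (energy js / sqrt 2)"
proof -
  have one: "2 * (\<Sum>T\<in>Pow {..<d}. sqrt (real (card (B \<inter> T))))
      \<le> 2 ^ d * (sqrt 2 * sqrt (real (card B)))"
    if "B \<subseteq> {..<d}" for B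
  proof -
    have "2 * (\<Sum>T\<in>Pow {..<d}. sqrt (real (card (B \<inter> T))))
        = (\<Sum>T\<in>Pow {..<d}. sqrt (real (card (B \<inter> T))) + sqrt (real (card (B \<inter> ({..<d} - T)))))"
      using sum_Pow_compl[of "{..<d}" "\<lambda>T. sqrt (real (card (B \<inter> T)))"] by (simp add: sum.distrib)
    also have "\<dots> \<le> (\<Sum>T\<in>Pow {..<d}. sqrt 2 * sqrt (real (card B)))"
    proof (rule sum_mono)
      fix T
      have B: "finite B" using that finite_subset by blast
      have "B \<inter> ({..<d} - T) = B - (B \<inter> T)" using that by auto
      then have "real (card (B \<inter> T)) + real (card (B \<inter> ({..<d} - T))) = real (card B)"
        using B card_Diff_subset[of "B \<inter> T" B] card_mono[of B "B \<inter> T"] by auto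
      moreover have "sqrt a + sqrt b \<le> sqrt 2 * sqrt (a + b)" if "a \<ge> 0" "b \<ge> 0" for a b
      proof -
        have "0 \<le> (sqrt a - sqrt b)\<^sup>2" by simp
        then have "(sqrt a + sqrt b)\<^sup>2 \<le> 2 * (a + b)"
          using that by (simp add: power2_sum power2_diff)
        then show ?thesis by (metis real_le_rsqrt real_sqrt_mult)
      qed
      ultimately show "sqrt (real (card (B \<inter> T))) + sqrt (real (card (B \<inter> ({..<d} - T))))
          \<le> sqrt 2 * sqrt (real (card B))"
        by (metis of_nat_0_le_iff)
    qed
    finally show ?thesis by (simp add: card_Pow)
  qed
  have "2 * (\<Sum>T\<in>Pow {..<d}. energy (filter (\<lambda>j. j \<in> T) js))
      = (\<Sum>x\<in>cube d. 2 * (\<Sum>T\<in>Pow {..<d}. sqrt (real (card ((N x \<inter> set js) \<inter> T)))))"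
  proof -
    have "N x \<inter> set (filter (\<lambda>j. j \<in> T) js) = (N x \<inter> set js) \<inter> T" for x T by auto
    then show ?thesis
      unfolding energy_def by (subst sum.swap) (simp add: sum_distrib_left)
  qed
  also have "\<dots> \<le> (\<Sum>x\<in>cube d. 2 ^ d * (sqrt 2 * sqrt (real (card (N x \<inter> set js)))))"
    using assms by (intro sum_mono one) auto
  also have "\<dots> = 2 * (2 ^ d * (energy js / sqrt 2))"
    by (simp add: energy_def real_div_sqrt field_simps flip: sum_distrib_left)
  finally show ?thesis by simp
qed

lemma sum_length_filter:
  assumes "set js \<subseteq> {..<d}"
  shows "(\<Sum>T\<in>Pow {..<d}. real (length (filter (\<lambda>j. j \<in> T) js))) = 2 ^ d * (real (length js) / 2)"
proof -
  have "2 * (\<Sum>T\<in>Pow {..<d}. real (length (filter (\<lambda>j. j \<in> T) js)))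
      = (\<Sum>T\<in>Pow {..<d}. real (length (filter (\<lambda>j. j \<in> T) js))
          + real (length (filter (\<lambda>j. j \<in> {..<d} - T) js)))"
    using sum_Pow_compl[of "{..<d}" "\<lambda>T. real (length (filter (\<lambda>j. j \<in> T) js))"]
    by (simp add: sum.distrib)
  also have "\<dots> = (\<Sum>T\<in>Pow {..<d}. real (length js))"
  proof (rule sum.cong[OF refl])
    fix T
    have "filter (\<lambda>j. j \<in> {..<d} - T) js = filter (\<lambda>j. \<not> j \<in> T) js"
      using assms by (auto intro!: filter_cong)
    then show "real (length (filter (\<lambda>j. j \<in> T) js))
        + real (length (filter (\<lambda>j. j \<in> {..<d} - T) js)) = real (length js)"
      using sum_length_filter_compl[of "\<lambda>j. j \<in> T" js] by simp
  qed
  finally show ?thesis by (simp add: card_Pow)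
qed

text \<open>The order of sorting matters, and the preceding bound requires an order that does not depend
  on \<open>S\<close>. The order is therefore randomized by repeated inverse riffle shuffles, which commute
  with restriction to a subset of the coordinates.\<close>

primrec mean_dist :: "nat \<Rightarrow> nat list \<Rightarrow> real" where
  "mean_dist 0 js = hdist d h (fold srt js h)"
| "mean_dist (Suc k) js = (\<Sum>S\<in>Pow {..<d}. mean_dist k (shuffle S js)) / 2 ^ d"

text \<open>With one shuffle, the list sorts its block in \<open>S\<close> first, and
  \<open>sum_hdist_rest_le\<close> bounds what the second block still changes. With more shuffles,
  the first one commutes with filtering, so the sums can be exchanged and the induction hypothesis
  applies.\<close>

lemma mean_dist_Suc_le:
  assumes "distinct js" "set js \<subseteq> {..<d}"
  shows "mean_dist (Suc k) js
    \<le> (\<Sum>T\<in>Pow {..<d}. mean_dist k (filter (\<lambda>j. j \<in> T) js)) / 2 ^ d + 4 * sqrt 2 * energy js"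
  using assms
proof (induction k arbitrary: js)
  case 0
  have "(\<Sum>S\<in>Pow {..<d}. mean_dist 0 (shuffle S js))
      \<le> (\<Sum>S\<in>Pow {..<d}. mean_dist 0 (filter (\<lambda>j. j \<in> S) js)
        + hdist d (sorted_on js S) (fold srt (filter (\<lambda>j. j \<notin> S) js) (sorted_on js S)))"
    by (intro sum_mono) (simp add: shuffle_def hdist_triangle)
  also have "\<dots> \<le> (\<Sum>S\<in>Pow {..<d}. mean_dist 0 (filter (\<lambda>j. j \<in> S) js))
      + 2 ^ d * (4 * sqrt 2 * energy js)"
    using sum_hdist_rest_le[OF 0] by (simp only: sum.distrib add_left_mono)
  finally show ?case by (simp add: field_simps)
next
  case (Suc k)
  have "(\<Sum>S\<in>Pow {..<d}. mean_dist (Suc k) (shuffle S js))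
      \<le> (\<Sum>S\<in>Pow {..<d}. (\<Sum>T\<in>Pow {..<d}. mean_dist k (filter (\<lambda>j. j \<in> T)
          (shuffle S js))) / 2 ^ d
        + 4 * sqrt 2 * energy (shuffle S js))"
    using Suc.prems by (intro sum_mono Suc.IH) auto
  also have "\<dots> = (\<Sum>S\<in>Pow {..<d}. \<Sum>T\<in>Pow {..<d}. mean_dist k (shuffle S (filter
      (\<lambda>j. j \<in> T) js)) / 2 ^ d)
      + 2 ^ d * (4 * sqrt 2 * energy js)"
    by (simp add: sum.distrib filter_shuffle energy_def card_Pow sum_divide_distrib)
  also have "(\<Sum>S\<in>Pow {..<d}. \<Sum>T\<in>Pow {..<d}. mean_dist k (shuffle S (filter
      (\<lambda>j. j \<in> T) js)) / 2 ^ d)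
      = (\<Sum>T\<in>Pow {..<d}. mean_dist (Suc k) (filter (\<lambda>j. j \<in> T) js))"
    by (subst sum.swap) (simp add: sum_divide_distrib)
  finally show ?case
    by (simp only: mean_dist.simps(2)[of "Suc k"]) (simp add: field_simps del: mean_dist.simps)
qed

text \<open>Each step halves the expected length and shrinks the expected energy by
  \<open>sqrt 2\<close>. The recursion starts from the crude bound that the distance is at most
  \<open>2 ^ d\<close>, and zero for the empty list.\<close>

lemma mean_dist_le:
  assumes "distinct js" "set js \<subseteq> {..<d}"
  shows "mean_dist k js \<le> 16 * sqrt 2 * energy js + 2 ^ d * real (length js) / 2 ^ k"
  using assms
proof (induction k arbitrary: js)
  case 0
  have "mean_dist 0 js \<le> 2 ^ d * real (length js)"
  proof (cases js)
    case Nil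
    then show ?thesis by (simp add: hdist_def)
  next
    case (Cons j ks)
    then have "(2 :: real) ^ d * 1 \<le> 2 ^ d * real (length js)" by (intro mult_left_mono) auto
    then show ?thesis unfolding mean_dist.simps using hdist_le[of d h "fold srt js h"] by linarith
  qed
  moreover have "0 \<le> 16 * sqrt 2 * energy js" using energy_nonneg[of js] by simp
  ultimately have "mean_dist 0 js \<le> 16 * sqrt 2 * energy js + 2 ^ d * real (length js)"
    by (intro add_increasing)
  then show ?case by simp
next
  case (Suc k)
  have "(\<Sum>T\<in>Pow {..<d}. mean_dist k (filter (\<lambda>j. j \<in> T) js))
      \<le> (\<Sum>T\<in>Pow {..<d}. 16 * sqrt 2 * energy (filter (\<lambda>j. j \<in> T) js)
        + 2 ^ d * real (length (filter (\<lambda>j. j \<in> T) js)) / 2 ^ k)"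
    using Suc.prems by (intro sum_mono Suc.IH) auto
  also have "\<dots> = 16 * sqrt 2 * (\<Sum>T\<in>Pow {..<d}. energy (filter (\<lambda>j. j \<in> T) js))
      + 2 ^ d * (2 ^ d * (real (length js) / 2)) / 2 ^ k"
    unfolding sum_length_filter[OF Suc.prems(2), symmetric]
    by (simp only: sum.distrib sum_distrib_left sum_divide_distrib)
  also have "\<dots> \<le> 16 * sqrt 2 * (2 ^ d * (energy js / sqrt 2))
      + 2 ^ d * (2 ^ d * (real (length js) / 2)) / 2 ^ k"
    using sum_energy_filter_le[OF Suc.prems(2)] by (intro add_right_mono mult_left_mono) auto
  also have "\<dots> = 2 ^ d * (16 * energy js + 2 ^ d * real (length js) / 2 ^ Suc k)"
    by (simp add: field_simps)
  finally have "(\<Sum>T\<in>Pow {..<d}. mean_dist k (filter (\<lambda>j. j \<in> T) js)) / 2 ^ d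
      \<le> 16 * energy js + 2 ^ d * real (length js) / 2 ^ Suc k"
    by (simp only: pos_divide_le_eq[of "2 ^ d"] zero_less_power zero_less_numeral mult.commute)
  then have "mean_dist (Suc k) js
      \<le> 16 * energy js + 2 ^ d * real (length js) / 2 ^ Suc k + 4 * sqrt 2 * energy js"
    using mean_dist_Suc_le[OF Suc.prems, of k] by linarith
  \<comment> \<open>The constant 16 closes the induction because
    \<open>16 + 4 * sqrt 2 \<le> 16 * sqrt 2\<close> amounts to
    \<open>4 / 3 \<le> sqrt 2\<close>.\<close>
  moreover have "(4 / 3 :: real) \<le> sqrt 2" by (rule real_le_rsqrt) (simp add: power2_eq_square)
  then have "16 * energy js + 4 * sqrt 2 * energy js \<le> 16 * sqrt 2 * energy js"
    using mult_right_mono[of "4 / 3" "sqrt 2" "12 * energy js"] energy_nonneg[of js] by simp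
  ultimately show ?case by linarith
qed

text \<open>The fully sorted function is monotone, so it differs from \<open>h\<close> at one point
  of each pair. These points are distinct, since \<open>h\<close> holds at all lower points and
  fails at all upper ones.\<close>

lemma violated_pairs_le_hdist:
  assumes "finite C" "inj_on x C" "inj_on y C"
    and "\<And>c. c \<in> C \<Longrightarrow> x c \<in> cube d \<and> y c \<in> cube d \<and> x c
        \<le> y c \<and> h (x c) \<and> \<not> h (y c)"
    and "set js = {..<d}"
  shows "real (card C) \<le> hdist d h (fold srt js h)"
proof -
  define g where "g = fold srt js h"
  have "mono_along d i g" if "i < d" for i
    unfolding g_def using assms(5) that by (intro mono_along_fold_srt) auto
  then have g: "g (y c)" if "c \<in> C" "g (x c)" for c
    using mono_if_mono_along[of d g "x c" "y c"] assms(4)[OF that(1)] that(2) by auto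
  have disj: "x ` C \<inter> y ` C = {}" using assms(4) by (metis (no_types, lifting) disjoint_iff imageE)
  have "real (card C) = (\<Sum>c\<in>C. 1)" by simp
  also have "\<dots> \<le> (\<Sum>c\<in>C. of_bool (h (x c) \<noteq> g (x c)) + of_bool (h (y c) \<noteq> g (y c)))"
    using assms(4) g by (intro sum_mono) (auto simp: of_bool_def)
  also have "\<dots> = (\<Sum>z\<in>x ` C \<union> y ` C. of_bool (h z \<noteq> g z))"
    using assms(1-3) disj by (subst sum.union_disjoint) (auto simp: sum.distrib sum.reindex simp del: sum_of_bool_eq)
  also have "\<dots> \<le> hdist d h g"
    unfolding hdist_def using assms(4) by (intro sum_mono2 finite_cube) auto
  finally show ?thesis by (simp add: g_def)
qed

text \<open>Sorting along all coordinates moves \<open>h\<close> by at least \<open>card C\<close>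
  in whatever order, hence also on average over shuffles. As the number of shuffles grows, the
  length term in \<open>mean_dist_le\<close> vanishes.\<close>

theorem boolean_directed_talagrand:
  assumes "finite C" "inj_on x C" "inj_on y C"
    and "\<And>c. c \<in> C \<Longrightarrow> x c \<in> cube d \<and> y c \<in> cube d \<and> x c
        \<le> y c \<and> h (x c) \<and> \<not> h (y c)"
  shows "real (card C) \<le> 16 * sqrt 2 * (\<Sum>x\<in>cube d. sqrt (real (card (N x))))"
proof -
  have lower: "real (card C) \<le> mean_dist k js" if "set js = {..<d}" for k js
    using that
  proof (induction k arbitrary: js)
    case 0
    then show ?case using violated_pairs_le_hdist[OF assms] by simp
  next
    case (Suc k)
    have "(\<Sum>S\<in>Pow {..<d}. real (card C)) \<le> (\<Sum>S\<in>Pow {..<d}. mean_dist k (shuffle S js))"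
      using Suc by (intro sum_mono Suc.IH) auto
    then show ?case by (simp add: card_Pow field_simps)
  qed
  have "real (card C) \<le> 16 * sqrt 2 * energy [0..<d] + 2 ^ d * real d / 2 ^ k" for k
    using lower[of "[0..<d]" k] mean_dist_le[of "[0..<d]" k] by (simp add: atLeast0LessThan)
  moreover have "(\<lambda>k. 16 * sqrt 2 * energy [0..<d]
      + 2 ^ d * real d / 2 ^ k) \<longlonglongrightarrow> 16 * sqrt 2 * energy [0..<d] + 0"
    by (intro tendsto_add tendsto_const tendsto_divide_0[OF tendsto_const] filterlim_realpow_sequentially_gt1 filterlim_at_top_imp_at_infinity) auto
  ultimately have "real (card C) \<le> 16 * sqrt 2 * energy [0..<d] + 0"
    by (intro LIMSEQ_le_const) auto
  moreover have "energy [0..<d] = (\<Sum>x\<in>cube d. sqrt (real (card (N x))))"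
    unfolding energy_def using N_subset by (intro sum.cong refl) (simp add: Int_absorb2 lessThan_atLeast0)
  ultimately show ?thesis by simp
qed

end

section \<open>Reduction of real-valued to Boolean functions\<close>

text \<open>The permutation sends each vertex to its successor and closes the cycle from
  \<open>a\<close> to \<open>b\<close>. Prepending a vertex \<open>x\<close> to a path that starts
  at \<open>y\<close> composes it with the transposition of \<open>x\<close> and
  \<open>y\<close>.\<close>

lemma permutation_of_distinct_path:
  assumes "rtrancl_path r b xs a" "distinct (b # xs)"
  shows "\<exists>p. p permutes set (b # xs) \<and> p a = b
      \<and> (\<forall>c\<in>set (b # xs). c \<noteq> a \<longrightarrow> r c (p c))"
  using assms
proof (induction rule: rtrancl_path.induct)
  case (base x)
  then show ?case using permutes_id by (intro exI[of _ id]) auto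
next
  case (step x y ys z)
  then obtain p where p: "p permutes set (y # ys)" "p z = y"
    and r: "\<And>c. c \<in> set (y # ys) \<Longrightarrow> c \<noteq> z \<Longrightarrow> r c (p c)" by auto
  have px: "p x = x" using permutes_not_in[OF p(1)] step.prems by simp
  have z: "z \<in> set (y # ys)" using p step.prems by (metis list.set_intros(1) permutes_in_image)
  let ?q = "Transposition.transpose x y \<circ> p"
  have "?q permutes set (x # y # ys)"
    by (intro permutes_compose permutes_subset[OF p(1)] permutes_swap_id) auto
  moreover have "?q z = x" using p by simp
  moreover have "r c (?q c)" if "c \<in> set (x # y # ys)" "c \<noteq> z" for c
  proof (cases "c = x")
    case True
    then show ?thesis using px step.hyps by simp
  next
    case False
    then have c: "c \<in> set (y # ys)" using that by auto
    have "p c \<noteq> y" using p that(2) by (metis permutes_inverses(2))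
    moreover have "p c \<noteq> x" using px False p(1) by (metis permutes_inverses(2))
    ultimately show ?thesis using r[OF c that(2)] by (simp add: transpose_def)
  qed
  ultimately show ?case by blast
qed

text \<open>A point may be both the lower end of one pair and the upper end of another one.\<close>

definition comparable_matchings :: "'a::order set \<Rightarrow> ('a \<times> 'a) set set" where
  "comparable_matchings V = {M. M \<subseteq> V \<times> V \<and> (\<forall>c\<in>M. fst c
      \<le> snd c) \<and> inj_on fst M \<and> inj_on snd M}"

definition drop_weight :: "('a \<Rightarrow> real) \<Rightarrow> ('a \<times> 'a) set \<Rightarrow> real" where
  "drop_weight f M = (\<Sum>c\<in>M. f (fst c) - f (snd c))"

text \<open>Maximal weight makes the pairs cover all violations; minimal size among the heaviest
  matchings excludes pairs that are not violated.\<close>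

locale optimal_matching =
  fixes V :: "'a::order set" and f :: "'a \<Rightarrow> real" and M :: "('a \<times> 'a) set"
  assumes finite_V: "finite V"
    and M: "M \<in> comparable_matchings V"
    and heaviest: "\<And>M'. M' \<in> comparable_matchings V \<Longrightarrow> drop_weight f M' \<le> drop_weight f M"
    and smallest: "\<And>M'. M' \<in> comparable_matchings V
        \<Longrightarrow> drop_weight f M' = drop_weight f M \<Longrightarrow> card M \<le> card M'"

lemma optimal_matching_exists:
  assumes "finite (V :: 'a::order set)"
  shows "\<exists>M. optimal_matching V f M"
proof -
  let ?X = "comparable_matchings V"
  have fin: "finite ?X"
    using assms by (intro finite_subset[of ?X "Pow (V \<times> V)"]) (auto simp: comparable_matchings_def)
  have ne: "{} \<in> ?X" by (simp add: comparable_matchings_def)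
  let ?m = "Max (drop_weight f ` ?X)"
  let ?Y = "{M \<in> ?X. drop_weight f M = ?m}"
  have "?m \<in> drop_weight f ` ?X" using fin ne by (intro Max_in) auto
  then obtain M0 where "M0 \<in> ?Y" by auto
  then obtain M where M: "M \<in> ?Y" "\<And>M'. M' \<in> ?Y \<Longrightarrow> card M \<le> card M'"
    using arg_min_natI[of "\<lambda>M. M \<in> ?Y" M0 card] arg_min_nat_le[of "\<lambda>M. M \<in> ?Y" _ card]
        by blast
  have "drop_weight f M' \<le> drop_weight f M" if "M' \<in> ?X" for M'
    using M(1) that fin by auto
  with M assms show ?thesis by (intro exI[of _ M]) (auto simp: optimal_matching_def)
qed

context optimal_matching
begin

lemma finite_M: "finite M"
  using M finite_V by (auto simp: comparable_matchings_def intro: finite_subset)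

lemma M_D: 
  assumes "c \<in> M" shows "fst c \<in> V" "snd c \<in> V" "fst c \<le> snd c"
  using M assms unfolding comparable_matchings_def by force+

lemma inj_M: "inj_on fst M" "inj_on snd M"
  using M by (auto simp: comparable_matchings_def)

text \<open>Otherwise the pair could be added, with a gain in weight.\<close>

lemma matching_covers_violations:
  assumes "u \<in> V" "v \<in> V" "u \<le> v" "f v < f u"
  shows "u \<in> fst ` M \<or> v \<in> snd ` M"
proof (rule ccontr)
  assume *: "\<not> ?thesis"
  then have new: "(u, v) \<notin> M" by force
  have "insert (u, v) M \<in> comparable_matchings V"
    using * assms M by (auto simp: comparable_matchings_def)
  then have "drop_weight f (insert (u, v) M) \<le> drop_weight f M" by (rule heaviest)
  then show False using new finite_M assms by (simp add: drop_weight_def)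
qed

text \<open>The weight depends only on the sets of lower and upper points, so \<open>M'\<close> is
  as heavy and as large as \<open>M\<close>. Removing a pair that is not violated would give a
  smaller matching of no less weight.\<close>

lemma rematching_violated:
  assumes M': "M' \<in> comparable_matchings V" and "fst ` M' = fst ` M" "snd ` M' = snd ` M" and c: "c \<in> M'"
  shows "f (snd c) < f (fst c)"
proof (rule ccontr)
  assume *: "\<not> ?thesis"
  have inj': "inj_on fst M'" "inj_on snd M'" using M' by (auto simp: comparable_matchings_def)
  have fin': "finite M'" using M' finite_V by (auto simp: comparable_matchings_def intro: finite_subset)
  have w: "drop_weight f L = (\<Sum>x\<in>fst ` L. f x) - (\<Sum>y\<in>snd ` L. f y)" 
    if "inj_on fst L" "inj_on snd L" for L
    using that by (simp add: drop_weight_def sum_subtractf sum.reindex)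
  have "drop_weight f M' = drop_weight f M"
    using w[OF inj'] w[OF inj_M] assms by simp
  moreover have "drop_weight f M' = (f (fst c) - f (snd c)) + drop_weight f (M' - {c})"
    unfolding drop_weight_def using fin' c by (rule sum.remove)
  ultimately have "drop_weight f M \<le> drop_weight f (M' - {c})" using * by simp
  moreover have sub: "M' - {c} \<in> comparable_matchings V"
    using M' by (auto simp: comparable_matchings_def intro: inj_on_subset)
  ultimately have "card M \<le> card (M' - {c})" using heaviest[OF sub] by (intro smallest) auto
  moreover have "card M' = card M"
    using inj' inj_M assms by (metis card_image)
  moreover have "card (M' - {c}) < card M'" using fin' c by (rule card_Diff1_less)
  ultimately show False by simp
qed

text \<open>These are the edges of the exchange graph: the lower point of \<open>a\<close> may be
  rematched with the upper point of \<open>b\<close>.\<close>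

definition leads :: "'a \<times> 'a \<Rightarrow> 'a \<times> 'a \<Rightarrow> bool" where
  "leads a b \<longleftrightarrow> a \<in> M \<and> b \<in> M \<and> fst a \<le> snd b"

text \<open>Rotating the partners along a cycle of \<open>leads\<close> keeps all pairs comparable and uses the same
  points; a pair that is not violated could then be dropped.\<close>

lemma violated_if_cyclic:
  assumes "leads a b" "leads\<^sup>*\<^sup>* b a"
  shows "f (snd b) < f (fst a)"
proof -
  obtain xs where "rtrancl_path leads b xs a" "distinct (b # xs)"
    using assms(2) by (metis rtranclp_eq_rtrancl_path rtrancl_path_distinct)
  from permutation_of_distinct_path[OF this] obtain p where
    p: "p permutes set (b # xs)" "p a = b" and lead: "\<And>c. c \<in> set (b # xs)
        \<Longrightarrow> c \<noteq> a \<Longrightarrow> leads c (p c)"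
    by blast
  have ab: "a \<in> M" "b \<in> M" "fst a \<le> snd b" using assms(1) by (auto simp: leads_def)
  have "set (b # xs) \<subseteq> M" using lead ab by (auto simp: leads_def)
  then have pM: "p permutes M" by (rule permutes_subset[OF p(1)])
  define M' where "M' = (\<lambda>c. (fst c, snd (p c))) ` M"
  have le: "fst c \<le> snd (p c)" if "c \<in> M" for c
  proof (cases "c = a \<or> c \<notin> set (b # xs)")
    case True
    then show ?thesis using ab(3) p(2) permutes_not_in[OF p(1), of c] M_D(3)[OF that] by auto
  next
    case False
    then show ?thesis using lead by (auto simp: leads_def)
  qed
  have image: "fst ` M' = fst ` M" "snd ` M' = snd ` M"
    using permutes_image[OF pM] by (simp_all add: M'_def image_image) (metis image_image)
  have "inj_on (\<lambda>c. snd (p c)) M"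
    using comp_inj_on[of p M snd] permutes_inj_on[OF pM] permutes_image[OF pM] inj_M by (simp add: o_def)
  then have "inj_on fst M'" "inj_on snd M'"
    using inj_M(1) by (auto simp: M'_def inj_on_def)
  then have "M' \<in> comparable_matchings V"
    using le M_D(1) M_D(2)[of "p _"] permutes_in_image[OF pM]
    by (auto simp: comparable_matchings_def M'_def)
  moreover have "(fst a, snd b) \<in> M'" using ab p by (auto simp: M'_def intro!: image_eqI[of _ _ a])
  ultimately show ?thesis using rematching_violated[of M' "(fst a, snd b)"] image by simp
qed

text \<open>This is the strongly connected component of \<open>a\<close> in the exchange
  graph.\<close>

definition component :: "'a \<times> 'a \<Rightarrow> ('a \<times> 'a) set" where
  "component a = {b \<in> M. leads\<^sup>*\<^sup>* a b \<and> leads\<^sup>*\<^sup>* b a}"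

definition extent :: "('a \<times> 'a) set \<Rightarrow> 'a set" where
  "extent C = {z. (\<exists>a\<in>C. fst a \<le> z) \<and> (\<exists>b\<in>C. z \<le> snd b)}"

text \<open>The level at which \<open>f\<close> is cut varies with the position. It is chosen so
  that all pairs of a component stay violated while no violation is invented; the first conjunct
  confines violations to the extent.\<close>

definition threshold :: "('a \<times> 'a) set \<Rightarrow> 'a \<Rightarrow> bool" where
  "threshold C z \<longleftrightarrow> (\<exists>a\<in>C. fst a \<le> z) \<and> (\<forall>b\<in>C. z
      \<le> snd b \<longrightarrow> f (snd b) < f z)"

lemma component_eq: "b \<in> component a \<Longrightarrow> component b = component a"
  unfolding component_def by (auto intro: rtranclp_trans)

text \<open>A common point lies above a lower point and below an upper point of either component, so
  each component leads to the other.\<close>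

lemma extents_disjoint:
  assumes "z \<in> extent (component a)" "z \<in> extent (component b)"
  shows "component a = component b"
proof -
  obtain a1 a2 b1 b2 where *: "a1 \<in> component a" "a2 \<in> component a" "b1 \<in> component b" "b2 \<in> component b"
    and le: "fst a1 \<le> z" "z \<le> snd a2" "fst b1 \<le> z" "z \<le> snd b2"
    using assms by (auto simp: extent_def)
  have "leads a1 b2" "leads b1 a2"
    using * le by (auto simp: leads_def component_def)
  moreover have "leads\<^sup>*\<^sup>* b2 b1" "leads\<^sup>*\<^sup>* a2 a1" "leads\<^sup>*\<^sup>* b1 b2"
    using * by (auto simp: component_def intro: rtranclp_trans)
  ultimately have "leads\<^sup>*\<^sup>* a1 b1" "leads\<^sup>*\<^sup>* b1 a1"
    by (meson converse_rtranclp_into_rtranclp rtranclp_trans)+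
  then have "b1 \<in> component a1" using *(3) by (simp add: component_def)
  then show ?thesis using component_eq * by metis
qed

text \<open>At \<open>fst c\<close>, any upper point of the component above it closes a cycle, so
  \<open>violated_if_cyclic\<close> applies. At \<open>snd c\<close>, the condition fails for the
  pair \<open>c\<close> itself.\<close>

lemma threshold_pairs:
  assumes "c \<in> component a"
  shows "threshold (component a) (fst c)" "\<not> threshold (component a) (snd c)"
proof -
  have "f (snd b) < f (fst c)" if "b \<in> component a" "fst c \<le> snd b" for b
  proof (rule violated_if_cyclic)
    show "leads c b" using that assms by (simp add: leads_def component_def)
    show "leads\<^sup>*\<^sup>* b c" using that assms by (auto simp: component_def intro: rtranclp_trans)
  qed
  then show "threshold (component a) (fst c)" using assms by (auto simp: threshold_def)
  show "\<not> threshold (component a) (snd c)" using assms by (auto simp: threshold_def)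
qed

text \<open>As \<open>v\<close> also lies above a lower point, it fails because of some upper point
  \<open>snd b\<close> above it with \<open>f v \<le> f (snd b)\<close>. That point lies above
  \<open>u\<close> as well, whence \<open>f (snd b) < f u\<close>.\<close>

lemma threshold_violation:
  assumes "threshold C u" "\<not> threshold C v" "u \<le> v"
  shows "f v < f u" "u \<in> extent C" "v \<in> extent C"
proof -
  obtain a where a: "a \<in> C" "fst a \<le> u" using assms by (auto simp: threshold_def)
  then obtain b where b: "b \<in> C" "v \<le> snd b" "f v \<le> f (snd b)"
    using assms unfolding threshold_def by (meson not_less order_trans)
  then have "f (snd b) < f u" using assms unfolding threshold_def by (meson order_trans)
  then show "f v < f u" using b by simp
  show "u \<in> extent C" "v \<in> extent C" using a b assms(3) by (auto simp: extent_def intro: order_trans)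
qed

lemma card_eq_sum_components: "card M = (\<Sum>C\<in>component ` M. card C)"
proof -
  have "M = \<Union>(component ` M)" by (auto simp: component_def)
  moreover have "disjoint (component ` M)"
    unfolding disjoint_def by (metis component_eq disjoint_iff imageE)
  moreover have "finite C" if "C \<in> component ` M" for C
    using that finite_M by (auto simp: component_def)
  ultimately show ?thesis using card_Union_disjoint[of "component ` M"] by auto
qed

end

text \<open>The extension takes the largest value of \<open>f\<close> at points of \<open>G\<close>
  below the argument. The minimum over \<open>V\<close> is the default where no such point exists;
  being a lower bound, it changes nothing on \<open>G\<close>.\<close>

lemma monotone_extension:
  fixes f :: "'a::order \<Rightarrow> real"
  assumes "finite V" "G \<subseteq> V"
    and "\<And>u v. u \<in> G \<Longrightarrow> v \<in> G \<Longrightarrow> u \<le> v \<Longrightarrow> f u \<le> f v"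
  obtains g where "mono_on V g" "\<And>x. x \<in> G \<Longrightarrow> g x = f x"
proof -
  define g where "g x = Max (insert (Min (f ` V)) (f ` {z \<in> G. z \<le> x}))" for x
  have fin: "finite {z \<in> G. z \<le> x}" for x using assms finite_subset by fastforce
  show thesis
  proof
    show "mono_on V g"
      unfolding monotone_on_def g_def using fin by (auto intro!: Max_mono)
    fix x assume x: "x \<in> G"
    show "g x = f x"
      unfolding g_def using fin x assms by (intro Max_eqI) (auto intro!: Min_le)
  qed
qed

section \<open>From matchings to the distance to monotonicity\<close>

lemma disagreement_eq: "disagreement d f g = real (card {x \<in> cube d. f x \<noteq> g x}) / 2 ^ d"
  unfolding disagreement_def
  by (simp add: measure_pmf_of_set finite_cube cube_nonempty card_cube Int_def conj_commute)

lemma dist_mono_le_disagreement: "mono_on (cube d) g \<Longrightarrow> dist_mono d f \<le> disagreement d f g"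
  unfolding dist_mono_def by (rule Min_le[OF finite_disagreements]) blast

lemma dist_mono_attained:
  obtains g where "mono_on (cube d) g" "dist_mono d f = disagreement d f g"
  using Min_in[OF finite_disagreements[of d f] disagreements_nonempty] unfolding dist_mono_def by blast

text \<open>Off the matched points \<open>f\<close> is already monotone, so it suffices to change
  \<open>f\<close> at these, at most two for each pair.\<close>

lemma dist_mono_le_matching:
  assumes "optimal_matching (cube d) f M"
  shows "2 ^ d * dist_mono d f \<le> 2 * real (card M)"
proof -
  interpret optimal_matching "cube d" f M by fact
  define B where "B = fst ` M \<union> snd ` M"
  have mono: "f u \<le> f v" if "u \<in> cube d - B" "v \<in> cube d - B" "u \<le> v" for u v
    using matching_covers_violations[of u v] that by (force simp: B_def)
  obtain g where g: "mono_on (cube d) g" "\<And>x. x \<in> cube d - B \<Longrightarrow> g x = f x"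
    by (rule monotone_extension[OF finite_cube Diff_subset, of d B f]) (use mono in auto)
  have "card {x \<in> cube d. f x \<noteq> g x} \<le> card B"
  proof (rule card_mono)
    show "finite B" using finite_M by (simp add: B_def)
    show "{x \<in> cube d. f x \<noteq> g x} \<subseteq> B" using g(2) by force
  qed
  also have "\<dots> \<le> card (fst ` M) + card (snd ` M)" unfolding B_def by (rule card_Un_le)
  also have "\<dots> \<le> 2 * card M"
      using card_image_le[OF finite_M, of fst] card_image_le[OF finite_M, of snd] by linarith
  finally have "real (card {x \<in> cube d. f x \<noteq> g x}) \<le> 2 * real (card M)" by simp
  moreover have "dist_mono d f \<le> real (card {x \<in> cube d. f x \<noteq> g x}) / 2 ^ d"
    using dist_mono_le_disagreement[OF g(1)] by (simp add: disagreement_eq)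
  ultimately show ?thesis by (simp add: field_simps)
qed

text \<open>The Boolean inequality is applied to the threshold function of each component, with the
  marks restricted to its extent. As extents are disjoint, a point contributes to at most one
  component. The factor 32 is 16 times the two points of each pair.\<close>

theorem directed_talagrand:
  fixes f :: "point \<Rightarrow> real" and N :: "point \<Rightarrow> nat set"
  assumes N_subset: "\<And>x. x \<in> cube d \<Longrightarrow> N x \<subseteq> {..<d}"
    and N_covers: "\<And>x i. x \<in> cube d \<Longrightarrow> i < d
        \<Longrightarrow> f (x(i := 0)) > f (x(i := 1)) \<Longrightarrow>
      i \<in> N (x(i := 0)) \<union> N (x(i := 1))"
  shows "2 ^ d * dist_mono d f \<le> 32 * sqrt 2 * (\<Sum>x\<in>cube d. sqrt (real (card (N x))))"
proof -
  obtain M where opt: "optimal_matching (cube d) f M"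
    using optimal_matching_exists[OF finite_cube] by blast
  interpret optimal_matching "cube d" f M by fact
  define N' where "N' C x = (if x \<in> extent C then N x else {})" for C x
  let ?C = "component ` M"
  have "real (card C) \<le> 16 * sqrt 2 * (\<Sum>x\<in>cube d. sqrt (real (card (N' C x))))" if C: "C \<in> ?C" for C
  proof -
    obtain a where a: "C = component a" using C by blast
    interpret vc: viol_cover d "threshold C" "N' C"
    proof
      fix x i assume x: "x \<in> cube d" "i < d" "threshold C (x(i := 0))" "\<not> threshold C (x(i := 1))"
      have "x(i := 0) \<le> x(i := 1)" by (auto simp: le_fun_def)
      note viol = threshold_violation[OF x(3,4) this]
      then show "i \<in> N' C (x(i := 0)) \<union> N' C (x(i := 1))"
        using N_covers[OF x(1,2)] by (simp add: N'_def)
    qed (use N_subset in \<open>auto simp: N'_def\<close>)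
    show ?thesis
    proof (rule vc.boolean_directed_talagrand[of C fst snd])
      show "finite C" "inj_on fst C" "inj_on snd C"
        using finite_M inj_M by (auto simp: a component_def intro: inj_on_subset)
      fix c assume "c \<in> C"
      then show "fst c \<in> cube d \<and> snd c \<in> cube d \<and> fst c
          \<le> snd c \<and> threshold C (fst c) \<and> \<not> threshold C (snd c)"
        using threshold_pairs[of c a] M_D[of c] by (auto simp: a component_def)
    qed
  qed
  then have "(\<Sum>C\<in>?C. real (card C))
      \<le> (\<Sum>C\<in>?C. 16 * sqrt 2 * (\<Sum>x\<in>cube d. sqrt (real (card (N' C x)))))"
    by (rule sum_mono)
  also have "\<dots> = 16 * sqrt 2 * (\<Sum>x\<in>cube d. \<Sum>C\<in>?C. sqrt (real (card (N' C x))))"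
    by (simp only: sum_distrib_left sum.swap[of _ _ ?C])
  also have "\<dots> \<le> 16 * sqrt 2 * (\<Sum>x\<in>cube d. sqrt (real (card (N x))))"
  proof (intro mult_left_mono sum_mono)
    fix x assume "x \<in> cube d"
    show "(\<Sum>C\<in>?C. sqrt (real (card (N' C x)))) \<le> sqrt (real (card (N x)))"
    proof (cases "\<exists>C\<in>?C. x \<in> extent C")
      case True
      then obtain C where C: "C \<in> ?C" "x \<in> extent C" by blast
      have "N' C' x = {}" if "C' \<in> ?C - {C}" for C'
        using that C extents_disjoint[of x] unfolding N'_def by (metis DiffE imageE singletonI)
      then have "(\<Sum>C'\<in>?C. sqrt (real (card (N' C' x)))) = sqrt (real (card (N' C x)))"
        using C finite_M by (subst sum.remove[of _ C]) auto
      then show ?thesis using C by (simp add: N'_def)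
    next
      case False
      then have "(\<Sum>C\<in>?C. sqrt (real (card (N' C x)))) = 0" by (intro sum.neutral) (auto simp: N'_def)
      then show ?thesis by simp
    qed
  qed auto
  finally have "real (card M) \<le> 16 * sqrt 2 * (\<Sum>x\<in>cube d. sqrt (real (card (N x))))"
    unfolding card_eq_sum_components by simp
  then show ?thesis using dist_mono_le_matching[OF opt] by simp
qed

section \<open>The local estimate\<close>

text \<open>The condition does not depend on \<open>x i\<close>, so a violated edge is listed at
  both of its ends.\<close>

definition viol_dirs :: "nat \<Rightarrow> (point \<Rightarrow> real) \<Rightarrow> point \<Rightarrow> nat set" where
  "viol_dirs d f x = {i. i < d \<and> f (x(i := 1)) < f (x(i := 0))}"

definition heavy_dirs :: "nat \<Rightarrow>
    (point \<Rightarrow> real) \<Rightarrow> point \<Rightarrow> nat set" where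
  "heavy_dirs d f x = {i \<in> viol_dirs d f x. card (viol_dirs d f (flip i x)) \<le> card (viol_dirs d f x)}"

text \<open>The value is 0 at points without violated edges, because of \<open>0 / 0 = 0\<close>.\<close>

definition weight :: "nat \<Rightarrow> (point \<Rightarrow> real) \<Rightarrow> point \<Rightarrow> real" where
  "weight d f x = real (card (heavy_dirs d f x)) / real (card (viol_dirs d f x))"

lemma finite_viol_dirs [simp]: "finite (viol_dirs d f x)"
  by (simp add: viol_dirs_def)

lemma heavy_subset_viol: "heavy_dirs d f x \<subseteq> viol_dirs d f x"
  by (auto simp: heavy_dirs_def)

lemma card_heavy_le: "card (heavy_dirs d f x) \<le> card (viol_dirs d f x)"
  by (rule card_mono[OF finite_viol_dirs heavy_subset_viol])

lemma weight_bounds: "0 \<le> weight d f x" "weight d f x \<le> 1"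
  using card_heavy_le[of d f x] by (auto simp: weight_def divide_le_eq)

lemma card_heavy_eq: "real (card (heavy_dirs d f x)) = weight d f x * real (card (viol_dirs d f x))"
  using card_heavy_le[of d f x] by (auto simp: weight_def)

lemma card_viol_le: "card (viol_dirs d f x) \<le> d"
  using card_mono[of "{..<d}" "viol_dirs d f x"] by (auto simp: viol_dirs_def)

lemma flip_flip: "x \<in> cube d \<Longrightarrow> i < d \<Longrightarrow> flip i (flip i x) = x"
  using cube_coord[of x d i] by fastforce

lemma viol_dirs_flip: "x \<in> cube d
    \<Longrightarrow> i \<in> viol_dirs d f (flip i x) \<longleftrightarrow> i \<in> viol_dirs d f x"
  by (simp add: viol_dirs_def)

lemma viol_imp_heavy:
  assumes "x \<in> cube d" "i \<in> viol_dirs d f x"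
  shows "i \<in> heavy_dirs d f x \<or> i \<in> heavy_dirs d f (flip i x)"
proof -
  have "i < d" using assms by (simp add: viol_dirs_def)
  then show ?thesis
    using assms flip_flip[of x d i] viol_dirs_flip[of x d i f] unfolding heavy_dirs_def by auto
qed

lemma sum_card_dirs:
  assumes "\<And>x. D x \<subseteq> {..<d}"
  shows "(\<Sum>x\<in>cube d. real (card (D x))) = (\<Sum>i<d. \<Sum>x\<in>cube d. of_bool (i \<in> D x))"
proof -
  have "real (card (D x)) = (\<Sum>i<d. of_bool (i \<in> D x))" for x
    using assms[of x] by (simp add: Int_absorb1)
  then show ?thesis by (simp only: sum.swap[of _ "cube d"])
qed

text \<open>Each violated edge counts twice on the left and is heavy at one of its ends at least;
  flipping moves the count from the other end.\<close>

lemma sum_viol_le: "(\<Sum>x\<in>cube d. real (card (viol_dirs d f x)))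
    \<le> 2 * (\<Sum>x\<in>cube d. real (card (heavy_dirs d f x)))"
proof -
  have sub: "viol_dirs d f x \<subseteq> {..<d}" "heavy_dirs d f x \<subseteq> {..<d}" for x
    by (auto simp: heavy_dirs_def viol_dirs_def)
  have "(\<Sum>i<d. \<Sum>x\<in>cube d. of_bool (i \<in> viol_dirs d f x))
      \<le> (\<Sum>i<d. \<Sum>x\<in>cube d. of_bool (i \<in> heavy_dirs d f x)
          + (of_bool (i \<in> heavy_dirs d f (flip i x)) :: real))"
  proof (intro sum_mono)
    fix i x assume "x \<in> cube d"
    then show "of_bool (i \<in> viol_dirs d f x)
        \<le> of_bool (i \<in> heavy_dirs d f x) + (of_bool (i \<in> heavy_dirs d f (flip i x)) :: real)"
      using viol_imp_heavy[of x d i f] by (auto simp: of_bool_def)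
  qed
  also have "\<dots> = (\<Sum>i<d. 2 * (\<Sum>x\<in>cube d. of_bool (i \<in> heavy_dirs d f x)))"
  proof (rule sum.cong[OF refl])
    fix i assume "i \<in> {..<d}"
    then have "(\<Sum>x\<in>cube d. of_bool (i \<in> heavy_dirs d f (flip i x)) :: real)
        = (\<Sum>x\<in>cube d. of_bool (i \<in> heavy_dirs d f x))"
      by (intro sum_flip) simp
    then show "(\<Sum>x\<in>cube d. of_bool (i \<in> heavy_dirs d f x)
        + (of_bool (i \<in> heavy_dirs d f (flip i x)) :: real))
        = 2 * (\<Sum>x\<in>cube d. of_bool (i \<in> heavy_dirs d f x))"
      unfolding sum.distrib by linarith
  qed
  finally show ?thesis
    unfolding sum_card_dirs[OF sub(1)] sum_card_dirs[OF sub(2)] sum_distrib_left .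
qed

lemma dist_mono_le_weight:
  assumes "d \<ge> 1"
  shows "2 ^ d * dist_mono d f \<le> 64 * sqrt (real d) * (\<Sum>x\<in>cube d. weight d f x)"
proof -
  \<comment> \<open>Here Cauchy-Schwarz takes the form of the arithmetic-geometric mean inequality.
    The scale \<open>t\<close> balances its two terms, because the degrees sum to at most
    \<open>2 * real d * W\<close>.\<close>
  define t W where "t = sqrt (2 * real d)" and "W = (\<Sum>x\<in>cube d. weight d f x)"
  have t: "t > 0" "t * t = 2 * real d" using assms by (auto simp: t_def)
  have "(\<Sum>x\<in>cube d. real (card (heavy_dirs d f x))) \<le> (\<Sum>x\<in>cube d. weight d f x * real d)"
    unfolding card_heavy_eq using card_viol_le weight_bounds by (intro sum_mono mult_left_mono) auto
  then have "(\<Sum>x\<in>cube d. real (card (viol_dirs d f x))) \<le> t * t * W"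
    using sum_viol_le[of d f] t(2)
        by (simp add: W_def sum_distrib_left[symmetric] sum_distrib_right[symmetric] mult.commute)
  then have edges: "(\<Sum>x\<in>cube d. real (card (viol_dirs d f x))) / t \<le> t * W"
    using t(1) by (simp add: divide_le_eq mult_ac)
  have "sqrt (real (card (heavy_dirs d f x))) \<le> (t * weight d f x + real (card (viol_dirs d f x)) / t) / 2" for x
  proof -
    have "real (card (heavy_dirs d f x)) = (t * weight d f x) * (real (card (viol_dirs d f x)) / t)"
      using t(1) by (simp add: card_heavy_eq)
    then show ?thesis
      using arith_geo_mean_sqrt[of "t * weight d f x" "real (card (viol_dirs d f x)) / t"] t(1) weight_bounds
      by simp
  qed
  then have "(\<Sum>x\<in>cube d. sqrt (real (card (heavy_dirs d f x))))
      \<le> (\<Sum>x\<in>cube d. (t * weight d f x + real (card (viol_dirs d f x)) / t) / 2)"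
    by (rule sum_mono)
  also have "\<dots> = (t * W + (\<Sum>x\<in>cube d. real (card (viol_dirs d f x))) / t) / 2"
    by (simp add: W_def sum.distrib sum_distrib_left flip: sum_divide_distrib)
  also have "\<dots> \<le> t * W"
  proof -
    have "(a + b) / 2 \<le> a" if "b \<le> a" for a b :: real using that by simp
    from this[OF edges] show ?thesis .
  qed
  finally have energy: "32 * sqrt 2 * (\<Sum>x\<in>cube d. sqrt (real (card (heavy_dirs d f x))))
      \<le> 32 * sqrt 2 * (t * W)"
    by (intro mult_left_mono) auto
  have "2 ^ d * dist_mono d f \<le> 32 * sqrt 2 * (\<Sum>x\<in>cube d. sqrt (real (card (heavy_dirs d f x))))"
  proof (rule directed_talagrand)
    fix x i assume x: "x \<in> cube d" "i < d" "f (x(i := 1)) < f (x(i := 0))"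
    then have "i \<in> viol_dirs d f (x(i := 0))" by (simp add: viol_dirs_def)
    then show "i \<in> heavy_dirs d f (x(i := 0)) \<union> heavy_dirs d f (x(i := 1))"
      using viol_imp_heavy[of "x(i := 0)" d i f] x by simp
  qed (auto simp: heavy_dirs_def viol_dirs_def)
  also note energy
  also have "32 * sqrt 2 * (t * W) = 64 * sqrt (real d) * W"
    by (simp add: t_def real_sqrt_mult)
  finally show ?thesis by (simp only: W_def)
qed

text \<open>The points at which \<open>f\<close> differs from a monotone function form a vertex cover of the violated
  edges, hence bound every fractional matching; edges between endpoints of equal degree count twice.\<close>

lemma weight_le_dist_mono: "(\<Sum>x\<in>cube d. weight d f x) \<le> 2 * (2 ^ d * dist_mono d f)"
proof -
  obtain g where g: "mono_on (cube d) g" "dist_mono d f = disagreement d f g"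
    by (rule dist_mono_attained)
  define B where "B = {x. f x \<noteq> g x}"
  define w where "w = (\<lambda>x i. of_bool (i \<in> heavy_dirs d f x) / real (card (viol_dirs d f x)))"
  have w: "weight d f x = (\<Sum>i<d. w x i)" for x
  proof -
    have "heavy_dirs d f x \<subseteq> {..<d}" by (auto simp: heavy_dirs_def viol_dirs_def)
    then have "real (card (heavy_dirs d f x)) = (\<Sum>i<d. of_bool (i \<in> heavy_dirs d f x))"
      by (simp add: Int_absorb1)
    then show ?thesis by (simp only: weight_def w_def sum_divide_distrib)
  qed
  have w0: "w x i \<ge> 0" for x i by (simp add: w_def)
  have cover: "w x i \<le> w x i * of_bool (x \<in> B) + w x i * of_bool (flip i x \<in> B)"
      if "x \<in> cube d" "i < d" for x i
  proof (cases "i \<in> heavy_dirs d f x")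
    case True
    then have viol: "f (x(i := 1)) < f (x(i := 0))" by (auto simp: heavy_dirs_def viol_dirs_def)
    have "g (x(i := 0)) \<le> g (x(i := 1))"
      using that by (intro monotone_onD[OF g(1)]) (auto simp: le_fun_def)
    then have "x(i := 0) \<in> B \<or> x(i := 1) \<in> B" using viol by (auto simp: B_def)
    moreover have "x(i := 0) = x \<and> x(i := 1) = flip i x \<or> x(i := 1) = x \<and> x(i := 0) = flip i x"
      using cube_coord[OF that] by (metis diff_self_eq_0 diff_zero fun_upd_triv)
    ultimately have "x \<in> B \<or> flip i x \<in> B" by auto
    then show ?thesis using w0[of x i] by auto
  qed (simp add: w_def)
  \<comment> \<open>An edge listed at a neighbour of \<open>x\<close> has its share computed from a
    degree no smaller than that of \<open>x\<close>, so charging it to \<open>x\<close> costs at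
    most the inverse degree of \<open>x\<close>.\<close>
  have flip_le: "w (flip i x) i * of_bool (x \<in> B)
      \<le> of_bool (i \<in> viol_dirs d f x) / real (card (viol_dirs d f x)) * of_bool (x \<in> B)"
    if "x \<in> cube d" "i < d" for x i
  proof (cases "i \<in> heavy_dirs d f (flip i x)")
    case True
    then have i: "i \<in> viol_dirs d f x"
      and le: "card (viol_dirs d f x) \<le> card (viol_dirs d f (flip i x))"
      using flip_flip[OF that] viol_dirs_flip[OF that(1)] by (auto simp: heavy_dirs_def)
    have "card (viol_dirs d f x) > 0" using i by (auto simp: card_gt_0_iff)
    then have "1 / real (card (viol_dirs d f (flip i x))) \<le> 1 / real (card (viol_dirs d f x))"
      using le by (intro divide_left_mono) auto
    then show ?thesis using True i by (simp add: w_def)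
  qed (simp add: w_def)
  have viol_sum: "(\<Sum>i<d. of_bool (i \<in> viol_dirs d f x) / real (card (viol_dirs d f x))) \<le> 1" for x
  proof -
    have "viol_dirs d f x \<subseteq> {..<d}" by (auto simp: viol_dirs_def)
    then have "(\<Sum>i<d. of_bool (i \<in> viol_dirs d f x)) = real (card (viol_dirs d f x))"
      by (simp add: Int_absorb1)
    then have "(\<Sum>i<d. of_bool (i \<in> viol_dirs d f x) / real (card (viol_dirs d f x)))
        = real (card (viol_dirs d f x)) / real (card (viol_dirs d f x))"
      by (simp only: flip: sum_divide_distrib)
    then show ?thesis by simp
  qed
  \<comment> \<open>Each point of \<open>B\<close> pays at most 1 for its own shares and at most 1
    for those of its neighbours, hence the factor 2.\<close>
  have "(\<Sum>x\<in>cube d. weight d f x)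
      \<le> (\<Sum>x\<in>cube d. \<Sum>i<d. w x i * of_bool (x \<in> B) + w x i * of_bool (flip i x \<in> B))"
    unfolding w by (intro sum_mono cover) auto
  also have "\<dots> = (\<Sum>x\<in>cube d. weight d f x * of_bool (x \<in> B))
      + (\<Sum>i<d. \<Sum>x\<in>cube d. w x i * of_bool (flip i x \<in> B))"
    by (simp only: sum.distrib w sum_distrib_right sum.swap[of _ "cube d" "{..<d}"])
  also have "(\<Sum>i<d. \<Sum>x\<in>cube d. w x i * of_bool (flip i x \<in> B))
      = (\<Sum>i<d. \<Sum>x\<in>cube d. w (flip i x) i * of_bool (x \<in> B))"
  proof (rule sum.cong[OF refl])
    fix i assume "i \<in> {..<d}"
    then have "(\<Sum>x\<in>cube d. w (flip i x) i * of_bool (flip i (flip i x) \<in> B))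
        = (\<Sum>x\<in>cube d. w x i * of_bool (flip i x \<in> B))"
      by (intro sum_flip) simp
    moreover have "(\<Sum>x\<in>cube d. w (flip i x) i * of_bool (flip i (flip i x) \<in> B))
        = (\<Sum>x\<in>cube d. w (flip i x) i * of_bool (x \<in> B))"
      using \<open>i \<in> {..<d}\<close> flip_flip by (intro sum.cong) (auto simp del: fun_upd_upd)
    ultimately show "(\<Sum>x\<in>cube d. w x i * of_bool (flip i x \<in> B))
        = (\<Sum>x\<in>cube d. w (flip i x) i * of_bool (x \<in> B))" by simp
  qed
  also have "\<dots> \<le> (\<Sum>i<d. \<Sum>x\<in>cube d. of_bool (i \<in> viol_dirs d f x) / real (card
      (viol_dirs d f x)) * of_bool (x \<in> B))"
    by (intro sum_mono flip_le) auto
  also have "\<dots> = (\<Sum>x\<in>cube d. (\<Sum>i<d. of_bool (i \<in> viol_dirs d f x) / real (card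
      (viol_dirs d f x))) * of_bool (x \<in> B))"
    by (simp only: sum_distrib_right sum.swap[of _ "cube d" "{..<d}"])
  also have "\<dots> \<le> (\<Sum>x\<in>cube d. of_bool (x \<in> B))"
    by (intro sum_mono) (use viol_sum in \<open>auto simp del: of_bool_eq_0_iff\<close>)
  also have "(\<Sum>x\<in>cube d. weight d f x * of_bool (x \<in> B)) \<le> (\<Sum>x\<in>cube d. of_bool (x \<in> B))"
    using weight_bounds by (intro sum_mono) auto
  finally have "(\<Sum>x\<in>cube d. weight d f x) \<le> 2 * (\<Sum>x\<in>cube d. of_bool (x \<in> B))" by simp
  also have "(\<Sum>x\<in>cube d. of_bool (x \<in> B)) = 2 ^ d * dist_mono d f"
    by (simp add: g(2) disagreement_eq B_def finite_cube Int_def)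
  finally show ?thesis .
qed

section \<open>The sampling algorithm\<close>

abbreviation tuples :: "'a set \<Rightarrow> nat \<Rightarrow> 'a list set" where
  "tuples V m \<equiv> {xs. set xs \<subseteq> V \<and> length xs = m}"

lemma sum_tuples_Suc: "(\<Sum>xs\<in>tuples V (Suc m). F xs) = (\<Sum>x\<in>V. \<Sum>xs\<in>tuples V m. F (x # xs))"
proof -
  have "tuples V (Suc m) = (\<lambda>(x, xs). x # xs) ` (V \<times> tuples V m)"
    by (auto simp: length_Suc_conv image_iff)
  moreover have "inj_on (\<lambda>(x, xs). x # xs) (V \<times> tuples V m)" by (auto simp: inj_on_def)
  ultimately show ?thesis by (simp add: sum.reindex sum.cartesian_product case_prod_unfold)
qed

text \<open>These are the first two moments of a sum of \<open>m\<close> independent centred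
  samples; the mixed terms vanish. Multiplying by \<open>card V\<close> avoids division.\<close>

lemma tuples_moments:
  fixes u :: "'a \<Rightarrow> real"
  assumes "finite V" "(\<Sum>x\<in>V. u x) = 0"
  shows "(\<Sum>xs\<in>tuples V m. sum_list (map u xs)) = 0 \<and>
    real (card V) * (\<Sum>xs\<in>tuples V m. (sum_list (map u xs))\<^sup>2)
      = real m * real (card V) ^ m * (\<Sum>x\<in>V. (u x)\<^sup>2)"
proof (induction m)
  case 0
  have "tuples V 0 = {[]}" by auto
  then show ?case by simp
next
  case (Suc m)
  have card: "card (tuples V m) = card V ^ m" by (rule card_lists_length_eq[OF assms(1)])
  define S1 where "S1 = (\<Sum>xs\<in>tuples V m. sum_list (map u xs))"
  define S2 where "S2 = (\<Sum>xs\<in>tuples V m. (sum_list (map u xs))\<^sup>2)"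
  have IH: "S1 = 0" "real (card V) * S2 = real m * real (card V) ^ m * (\<Sum>x\<in>V. (u x)\<^sup>2)"
    using Suc by (auto simp: S1_def S2_def)
  have "(\<Sum>xs\<in>tuples V m. sum_list (map u (x # xs))) = real (card V) ^ m * u x + S1" for x
    by (simp add: sum.distrib card S1_def)
  then have "(\<Sum>xs\<in>tuples V (Suc m). sum_list (map u xs)) = (\<Sum>x\<in>V. real (card V) ^ m * u x + S1)"
    by (simp only: sum_tuples_Suc)
  also have "\<dots> = 0" using IH assms(2) by (simp flip: sum_distrib_left)
  finally have first: "(\<Sum>xs\<in>tuples V (Suc m). sum_list (map u xs)) = 0" .
  have "(\<Sum>xs\<in>tuples V m. (sum_list (map u (x # xs)))\<^sup>2)
      = real (card V) ^ m * (u x)\<^sup>2 + 2 * u x * S1 + S2" for x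
    by (simp add: power2_sum sum.distrib card S1_def S2_def sum_distrib_left mult_ac)
  then have "(\<Sum>xs\<in>tuples V (Suc m). (sum_list (map u xs))\<^sup>2)
      = (\<Sum>x\<in>V. real (card V) ^ m * (u x)\<^sup>2 + 2 * u x * S1 + S2)"
    by (simp only: sum_tuples_Suc)
  also have "\<dots> = real (card V) ^ m * (\<Sum>x\<in>V. (u x)\<^sup>2) + real (card V) * S2"
    by (simp add: sum.distrib IH(1) flip: sum_distrib_left)
  finally have "real (card V) * (\<Sum>xs\<in>tuples V (Suc m). (sum_list (map u xs))\<^sup>2)
      = real (Suc m) * real (card V) ^ Suc m * (\<Sum>x\<in>V. (u x)\<^sup>2)"
    using IH(2) by (simp add: algebra_simps)
  with first show ?case by blast
qed

text \<open>This is Chebyshev's inequality. Values in the unit interval satisfy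
  \<open>(w x)\<^sup>2 \<le> w x\<close>, so the variance is at most \<open>\<omega>\<close>, and
  the failure probability is at most \<open>4 / (real m * \<omega>)\<close>; the constant 12 makes
  this at most \<open>1 / 3\<close>.\<close>

lemma sample_mean_concentration:
  fixes w :: "'a \<Rightarrow> real"
  assumes V: "finite V" "V \<noteq> {}" and w: "\<And>x. x \<in> V \<Longrightarrow> 0 \<le> w x \<and> w x \<le> 1"
  defines "\<omega> \<equiv> (\<Sum>x\<in>V. w x) / real (card V)"
  assumes \<omega>: "\<omega> > 0" and m: "real m * \<omega> \<ge> 12"
  shows "measure_pmf.prob (pmf_of_set (tuples V m))
    {xs. \<bar>sum_list (map w xs) / real m - \<omega>\<bar> \<le> \<omega> / 2} \<ge> 2 / 3"
proof -
  define n where "n = real (card V)"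
  define L where "L = tuples V m"
  define Bad where "Bad = {xs \<in> L. \<not> \<bar>sum_list (map w xs) / real m - \<omega>\<bar> \<le> \<omega> / 2}"
  define u where "u x = w x - \<omega>" for x
  have n: "n > 0" using V by (simp add: n_def card_gt_0_iff)
  have m0: "m > 0" using m by (cases m) auto
  have finL: "finite L" unfolding L_def by (rule finite_lists_length_eq[OF V(1)])
  have cardL: "real (card L) = n ^ m" unfolding L_def n_def card_lists_length_eq[OF V(1)] by simp
  have neL: "L \<noteq> {}" using cardL n by force
  have sw: "(\<Sum>x\<in>V. w x) = n * \<omega>" using n by (simp add: \<omega>_def n_def)
  have u0: "(\<Sum>x\<in>V. u x) = 0" by (simp add: u_def sum_subtractf sw n_def)
  have "(\<Sum>x\<in>V. (u x)\<^sup>2) \<le> (\<Sum>x\<in>V. w x - 2 * \<omega> * w x + \<omega>\<^sup>2)"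
  proof (rule sum_mono)
    fix x assume "x \<in> V"
    then have "(w x)\<^sup>2 \<le> w x" using w by (simp add: power2_eq_square mult_left_le)
    then show "(u x)\<^sup>2 \<le> w x - 2 * \<omega> * w x + \<omega>\<^sup>2" by (simp add: u_def power2_diff)
  qed
  also have "\<dots> = n * \<omega> - n * \<omega>\<^sup>2"
    by (simp add: sum.distrib sum_subtractf sw power2_eq_square n_def[symmetric] flip: sum_distrib_left)
  also have "\<dots> \<le> n * \<omega>" using n by simp
  finally have var: "(\<Sum>x\<in>V. (u x)\<^sup>2) \<le> n * \<omega>" .
  have dev: "sum_list (map u xs) = sum_list (map w xs) - real (length xs) * \<omega>" for xs
    by (induction xs) (auto simp: u_def algebra_simps)
  have large: "(real m * \<omega> / 2)\<^sup>2 \<le> (sum_list (map u xs))\<^sup>2" if "xs \<in> Bad" for xs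
  proof -
    have "length xs = m" "\<omega> / 2 < \<bar>sum_list (map w xs) / real m - \<omega>\<bar>"
      using that by (auto simp: Bad_def L_def)
    moreover have "sum_list (map w xs) / real m - \<omega> = (sum_list (map w xs) - real m * \<omega>) / real m"
      using m0 by (simp add: field_simps)
    ultimately have "real m * \<omega> / 2 \<le> \<bar>sum_list (map u xs)\<bar>"
      using m0 by (simp add: dev field_simps)
    then have "\<bar>real m * \<omega> / 2\<bar> \<le> \<bar>sum_list (map u xs)\<bar>" using \<omega> by simp
    then show ?thesis by (simp only: abs_le_square_iff)
  qed
  have "real (card Bad) * (real m * \<omega> / 2)\<^sup>2
      = (\<Sum>xs\<in>Bad. (real m * \<omega> / 2)\<^sup>2)" by simp
  also have "\<dots> \<le> (\<Sum>xs\<in>Bad. (sum_list (map u xs))\<^sup>2)" by (intro sum_mono large)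
  also have "\<dots> \<le> (\<Sum>xs\<in>L. (sum_list (map u xs))\<^sup>2)"
    using finL by (intro sum_mono2) (auto simp: Bad_def)
  finally have "n * (real (card Bad) * (real m * \<omega> / 2)\<^sup>2)
      \<le> n * (\<Sum>xs\<in>L. (sum_list (map u xs))\<^sup>2)"
    using n by simp
  also have "\<dots> = real m * n ^ m * (\<Sum>x\<in>V. (u x)\<^sup>2)"
    using tuples_moments[OF V(1) u0, of m] by (simp add: n_def L_def)
  also have "\<dots> \<le> real m * n ^ m * (n * \<omega>)"
    using n by (intro mult_left_mono[OF var]) auto
  finally have "(n * (real m * \<omega>)) * (real (card Bad) * (real m * \<omega>))
      \<le> (n * (real m * \<omega>)) * (4 * n ^ m)"
    by (simp add: power2_eq_square algebra_simps)
  then have "real (card Bad) * (real m * \<omega>) \<le> 4 * n ^ m"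
    by (rule mult_left_le_imp_le) (use n m0 \<omega> in simp)
  moreover have "real (card Bad) * 12
      \<le> real (card Bad) * (real m * \<omega>)" using m by (intro mult_left_mono) auto
  ultimately have bad: "real (card Bad) \<le> n ^ m / 3" by simp
  have "L \<inter> {xs. \<bar>sum_list (map w xs) / real m - \<omega>\<bar>
      \<le> \<omega> / 2} = L - Bad" by (auto simp: Bad_def)
  moreover have "card (L - Bad) = card L - card Bad" "card Bad \<le> card L"
    using finL by (auto simp: Bad_def intro!: card_Diff_subset card_mono)
  ultimately have "measure_pmf.prob (pmf_of_set L) {xs. \<bar>sum_list (map w xs) / real m - \<omega>\<bar>
      \<le> \<omega> / 2}
      = (n ^ m - real (card Bad)) / n ^ m"
    using finL neL cardL by (simp add: measure_pmf_of_set of_nat_diff)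
  moreover have "2 / 3 \<le> (n ^ m - real (card Bad)) / n ^ m"
    using bad n by (simp add: le_divide_eq)
  ultimately show ?thesis by (simp add: L_def)
qed

section \<open>Queries fixed in advance and the estimator\<close>

primrec ask :: "point list \<Rightarrow> (real list \<Rightarrow> real) \<Rightarrow> query_alg" where
  "ask [] out = Output (out [])"
| "ask (q # qs) out = Query q (\<lambda>r. ask qs (\<lambda>rs. out (r # rs)))"

lemma run_ask: "run (ask qs out) f = out (map f qs)"
  by (induction qs arbitrary: out) auto

lemma queries_ask: "queries (ask qs out) f = qs"
  by (induction qs arbitrary: out) auto

text \<open>The weight of \<open>x\<close> involves the degrees of its neighbours, hence
  \<open>f\<close> at distance up to two. The choice \<open>i = j\<close> yields the points at
  distance at most one.\<close>

definition neighbourhood :: "nat \<Rightarrow> point \<Rightarrow> point list" where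
  "neighbourhood d x = [x(i := a, j := b). i \<leftarrow> [0..<d], j \<leftarrow> [0..<d], a \<leftarrow> [0, 1], b \<leftarrow> [0, 1]]"

lemma length_neighbourhood: "length (neighbourhood d x) = 4 * d\<^sup>2"
  by (simp add: neighbourhood_def length_concat o_def sum_list_triv power2_eq_square)

lemma set_neighbourhood:
  "set (neighbourhood d x) = (\<Union>i<d. \<Union>j<d. \<Union>a\<le>1. \<Union>b\<le>1. {x(i := a, j := b)})"
proof -
  have *: "{..1} = {0, 1 :: nat}" by auto
  show ?thesis unfolding * by (simp add: neighbourhood_def lessThan_atLeast0 insert_commute)
qed

lemma viol_dirs_cong:
  assumes "\<And>i b. i < d \<Longrightarrow> b \<le> 1 \<Longrightarrow> f (x(i := b)) = g (x(i := b))"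
  shows "viol_dirs d f x = viol_dirs d g x"
  using assms by (auto simp: viol_dirs_def)

lemma weight_cong:
  assumes "\<And>y. y \<in> set (neighbourhood d x) \<Longrightarrow> f y = g y"
  shows "weight d f x = weight d g x"
proof -
  have eq: "f (x(i := a, j := b)) = g (x(i := a, j := b))" if "i < d" "j < d" "a \<le> 1" "b \<le> 1" for i j a b
    using that by (intro assms) (auto simp: set_neighbourhood)
  have v: "viol_dirs d f x = viol_dirs d g x"
    using eq[of i i for i] by (intro viol_dirs_cong) (metis fun_upd_upd)
  have n: "viol_dirs d f (flip i x) = viol_dirs d g (flip i x)" if "i \<in> viol_dirs d g x" for i
    using that by (intro viol_dirs_cong eq) (auto simp: viol_dirs_def)
  have "heavy_dirs d f x = heavy_dirs d g x"
    unfolding heavy_dirs_def v using n by (metis (no_types, lifting))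
  then show ?thesis by (simp add: weight_def v)
qed

text \<open>The factor 128 is twice the 64 in \<open>dist_mono_le_weight\<close>, because the sample
  mean may fall to half of the true mean.\<close>

definition estimate :: "nat \<Rightarrow> point list \<Rightarrow>
    (point \<Rightarrow> real) \<Rightarrow> real" where
  "estimate d xs f = 128 * sqrt (real d) * (sum_list (map (weight d f) xs) / real (length xs))"

definition sample_queries :: "nat \<Rightarrow> point list \<Rightarrow> point list" where
  "sample_queries d xs = concat (map (neighbourhood d) xs)"

text \<open>The answers serve as a lookup table standing in for the oracle. Values off the table are
  arbitrary, but by \<open>weight_cong\<close> they do not influence the estimate.\<close>

definition estimator :: "nat \<Rightarrow> point list \<Rightarrow> query_alg" where
  "estimator d xs = ask (sample_queries d xs)
     (\<lambda>rs. estimate d xs (\<lambda>q. the (map_of (zip (sample_queries d xs) rs) q)))"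

lemma run_estimator: "run (estimator d xs) f = estimate d xs f"
proof -
  define g where "g = (\<lambda>q. the (map_of (zip (sample_queries d xs) (map f (sample_queries d xs))) q))"
  have "g y = f y" if "y \<in> set (sample_queries d xs)" for y
    using that by (simp add: g_def map_of_zip_map)
  then have "weight d g x = weight d f x" if "x \<in> set xs" for x
    using that by (intro weight_cong) (auto simp: sample_queries_def)
  then have "map (weight d g) xs = map (weight d f) xs" by simp
  then show ?thesis
    unfolding estimator_def run_ask estimate_def g_def[symmetric] by (rule arg_cong)
qed

text \<open>Since the mean weight is at least \<open>\<alpha> / (64 * sqrt (real d))\<close>, the
  constant \<open>768 = 12 * 64\<close> meets the requirement of
  \<open>sample_mean_concentration\<close>.\<close>

definition sample_size :: "nat \<Rightarrow> real \<Rightarrow> nat" where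
  "sample_size d \<alpha> = nat \<lceil>768 * sqrt (real d) / \<alpha>\<rceil>"

definition dist_algorithm :: "nat \<Rightarrow> real \<Rightarrow> query_alg pmf" where
  "dist_algorithm d \<alpha> = map_pmf (estimator d) (pmf_of_set (tuples (cube d) (sample_size d \<alpha>)))"

lemma set_dist_algorithm:
  assumes "A \<in> set_pmf (dist_algorithm d \<alpha>)"
  obtains xs where "set xs \<subseteq> cube d" "length xs = sample_size d \<alpha>" "A = estimator d xs"
proof -
  have "finite (tuples (cube d) (sample_size d \<alpha>))"
    by (rule finite_lists_length_eq[OF finite_cube])
  moreover have "tuples (cube d) (sample_size d \<alpha>) \<noteq> {}"
  proof -
    obtain x where "x \<in> cube d" using cube_nonempty by blast
    then have "replicate (sample_size d \<alpha>) x \<in> tuples (cube d) (sample_size d \<alpha>)" by auto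
    then show ?thesis by blast
  qed
  ultimately show thesis using assms that by (auto simp: dist_algorithm_def)
qed

lemma queries_dist_algorithm:
  assumes "A \<in> set_pmf (dist_algorithm d \<alpha>)"
  shows "set (queries A f) \<subseteq> cube d" "length (queries A f) = sample_size d \<alpha> * (4 * d\<^sup>2)"
    "queries A f = queries A g"
proof -
  obtain xs where xs: "set xs \<subseteq> cube d" "length xs = sample_size d \<alpha>" "A = estimator d xs"
    using assms by (rule set_dist_algorithm)
  have q: "queries A f = sample_queries d xs" for f by (simp add: xs(3) estimator_def queries_ask)
  show "set (queries A f) \<subseteq> cube d"
    using xs(1) by (auto simp: q sample_queries_def set_neighbourhood)
  show "length (queries A f) = sample_size d \<alpha> * (4 * d\<^sup>2)"
    by (simp add: q sample_queries_def length_concat o_def length_neighbourhood sum_list_triv xs(2))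
  show "queries A f = queries A g" by (simp add: q)
qed

lemma dist_algorithm_correct:
  assumes d: "d \<ge> 1" and \<alpha>: "0 < \<alpha>" and far: "far_from_mono d \<alpha> f"
  shows "measure_pmf.prob (dist_algorithm d \<alpha>)
    {A. dist_mono d f \<le> run A f \<and> run A f \<le> 384 * sqrt (real d) * dist_mono d f} \<ge> 2 / 3"
proof -
  define s m where "s = sqrt (real d)" and "m = sample_size d \<alpha>"
  define \<omega> where "\<omega> = (\<Sum>x\<in>cube d. weight d f x) / real (card (cube d))"
  let ?G = "{xs. \<bar>sum_list (map (weight d f) xs) / real m - \<omega>\<bar> \<le> \<omega> / 2}"
  let ?H = "{xs. dist_mono d f \<le> run (estimator d xs) f \<and> run (estimator d xs) f
      \<le> 384 * s * dist_mono d f}"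
  have s: "s > 0" using d by (simp add: s_def)
  have low: "dist_mono d f \<le> 64 * s * \<omega>"
    using dist_mono_le_weight[OF d, of f] by (simp add: \<omega>_def s_def card_cube field_simps)
  have up: "\<omega> \<le> 2 * dist_mono d f"
    using weight_le_dist_mono[of d f] by (simp add: \<omega>_def card_cube field_simps)
  have "\<alpha> \<le> 64 * s * \<omega>" using low far by (simp add: far_from_mono_def)
  then have \<omega>: "\<omega> > 0" using \<alpha> s
      by (metis less_le_trans mult_pos_pos zero_less_mult_pos zero_less_numeral)
  have "12 \<le> 768 * s / \<alpha> * \<omega>"
    using \<open>\<alpha> \<le> 64 * s * \<omega>\<close> \<alpha> by (simp add: field_simps)
  also have "\<dots> \<le> real m * \<omega>"
    using \<omega> unfolding m_def sample_size_def s_def by (intro mult_right_mono) linarith+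
  finally have m: "12 \<le> real m * \<omega>" .
  let ?P = "pmf_of_set (tuples (cube d) m)"
  have "2 / 3 \<le> measure_pmf.prob ?P ?G"
    using m \<omega> weight_bounds unfolding \<omega>_def
    by (intro sample_mean_concentration finite_cube cube_nonempty) auto
  also have "\<dots> = measure_pmf.prob ?P (?G \<inter> set_pmf ?P)"
    by (simp add: measure_Int_set_pmf)
  also have "\<dots> \<le> measure_pmf.prob ?P ?H"
  proof (rule measure_pmf.finite_measure_mono)
    have fin: "finite (tuples (cube d) m)" by (rule finite_lists_length_eq[OF finite_cube])
    have "replicate m (SOME x. x \<in> cube d) \<in> tuples (cube d) m"
      using cube_nonempty some_in_eq[of "cube d"] by auto
    then have "set_pmf ?P = tuples (cube d) m" using fin by (intro set_pmf_of_set) auto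
    moreover have "xs \<in> ?H" if "xs \<in> ?G" "length xs = m" for xs
    proof -
      define e where "e = sum_list (map (weight d f) xs) / real m"
      have run: "run (estimator d xs) f = 128 * s * e"
        using that(2) by (simp add: run_estimator estimate_def e_def s_def)
      have e: "\<omega> / 2 \<le> e" "e
          \<le> 3 * \<omega> / 2" using that(1) unfolding mem_Collect_eq e_def[symmetric] by linarith+
      \<comment> \<open>The constant 384 is \<open>128 * (3 / 2) * 2\<close>: the estimate may use a
        sample mean half too large, and the true mean is at most twice the distance.\<close>
      have "64 * s * \<omega> \<le> 128 * s * e" using mult_left_mono[OF e(1), of "128 * s"] s by simp
      moreover have "128 * s * e \<le> 192 * s * \<omega>" using mult_left_mono[OF e(2), of "128 * s"] s by simp
      moreover have "192 * s * \<omega> \<le> 384 * s * dist_mono d f"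
        using mult_left_mono[OF up, of "192 * s"] s by simp
      ultimately show ?thesis using low unfolding mem_Collect_eq run by linarith
    qed
    ultimately show "?G \<inter> set_pmf ?P \<subseteq> ?H" by blast
  qed simp
  also have "\<dots> = measure_pmf.prob (dist_algorithm d \<alpha>)
      {A. dist_mono d f \<le> run A f \<and> run A f \<le> 384 * s * dist_mono d f}"
    by (simp add: dist_algorithm_def m_def vimage_def)
  finally show ?thesis by (simp add: s_def)
qed

text \<open>Rounding up costs at most 1, which is at most \<open>real d * (1 / \<alpha>)\<close>;
  hence 769, and 3076 with the four points for each pair of directions. The power of
  \<open>1 / \<alpha>\<close> is raised to 3 so that a single exponent serves both
  parameters.\<close>

lemma dist_algorithm_query_bound:
  assumes "d \<ge> 1" "0 < \<alpha>" "\<alpha> < 1"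
  shows "real (sample_size d \<alpha> * (4 * d\<^sup>2)) \<le> 3076 * real d ^ 3 * (1 / \<alpha>) ^ 3"
proof -
  have d: "1 \<le> real d" and a: "1 \<le> 1 / \<alpha>" using assms by auto
  have da: "1 \<le> real d * (1 / \<alpha>)" using mult_mono[OF d a] by simp
  have "sqrt (real d) \<le> real d" using d by (intro real_le_lsqrt) (auto simp: power2_eq_square)
  then have "768 * sqrt (real d) / \<alpha> \<le> 768 * (real d * (1 / \<alpha>))"
    using assms by (simp add: divide_right_mono)
  moreover have "real (sample_size d \<alpha>) \<le> 768 * sqrt (real d) / \<alpha> + 1"
  proof -
    have "0 \<le> 768 * sqrt (real d) / \<alpha>" using assms by simp
    then show ?thesis unfolding sample_size_def by linarith
  qed
  ultimately have "real (sample_size d \<alpha>) \<le> 769 * (real d * (1 / \<alpha>))" using da by linarith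
  then have "real (sample_size d \<alpha>) * (4 * (real d)\<^sup>2)
      \<le> 769 * (real d * (1 / \<alpha>)) * (4 * (real d)\<^sup>2)"
    by (rule mult_right_mono) simp
  also have "\<dots> = 3076 * real d ^ 3 * (1 / \<alpha>)" by (simp add: power2_eq_square power3_eq_cube)
  also have "\<dots> \<le> 3076 * real d ^ 3 * (1 / \<alpha>) ^ 3"
    using power_increasing[OF _ a, of 1 3] by (intro mult_left_mono) auto
  finally show ?thesis by simp
qed

theorem theorem1p8:
  "\<exists>(P :: nat \<Rightarrow> real \<Rightarrow> query_alg pmf) (c :: nat \<Rightarrow> real) (K :: real)
      (k :: nat).
     c \<in> O(\<lambda>d. sqrt (real d * ln (real d))) \<and>
     (\<forall>d\<ge>1. c d > 1 \<and> approx_algorithm d (c d) (P d) \<and>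
        (\<forall>\<alpha>\<in>{0<..<1}. nonadaptive (P d \<alpha>) \<and>
           makes_at_most (P d \<alpha>) (K * real d ^ k * (1 / \<alpha>) ^ k)))"
proof (intro exI conjI allI impI ballI)
  show "(\<lambda>d. 384 * sqrt (real d)) \<in> O(\<lambda>d. sqrt (real d * ln (real d)))"
  \<comment> \<open>From \<open>d = 3\<close> on the logarithm is at least 1, so the bound of order
    \<open>sqrt (real d)\<close> suffices.\<close>
  proof (rule bigoI[of _ 384], rule eventually_mono[OF eventually_ge_at_top[of 3]])
    fix d :: nat assume "d \<ge> 3"
    then have "exp 1 \<le> real d" using exp_le by linarith
    then have "1 \<le> ln (real d)" using \<open>d \<ge> 3\<close> by (simp add: ln_ge_iff)
    then have "real d * 1 \<le> real d * ln (real d)" by (intro mult_left_mono) auto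
    then show "norm (384 * sqrt (real d)) \<le> 384 * norm (sqrt (real d * ln (real d)))" by simp
  qed
  fix d :: nat assume d: "d \<ge> 1"
  then have "1 \<le> sqrt (real d)" by simp
  then show "384 * sqrt (real d) > 1" by linarith
  show "approx_algorithm d (384 * sqrt (real d)) (dist_algorithm d)"
    using d queries_dist_algorithm(1) dist_algorithm_correct
    by (auto simp: approx_algorithm_def queries_in_cube_def)
  fix \<alpha> :: real assume \<alpha>: "\<alpha> \<in> {0<..<1}"
  show "nonadaptive (dist_algorithm d \<alpha>)"
    unfolding nonadaptive_def using queries_dist_algorithm(3) by blast
  show "makes_at_most (dist_algorithm d \<alpha>) (3076 * real d ^ 3 * (1 / \<alpha>) ^ 3)"
    using dist_algorithm_query_bound[OF d, of \<alpha>] \<alpha> queries_dist_algorithm(2)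
    by (simp add: makes_at_most_def del: of_nat_mult)
qed

end
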